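(* Let $\mathcal{C}$ be a cubical complex with a stable shelling. Then the $h$-polynomial $h(\mathrm{sd}(\mathcal{C});x)$ of its barycentric subdivision is real-rooted.
   Context: A polytopal complex is a collection of (abstract) polytopes that contains the empty polytope $\emptyset$ (of dimension $-1$), is closed under taking faces, and in which any two members intersect in a common face of both. Its maximal members are its facets; it is pure if all facets have the same dimension; it is cubical if all facets are (combinatorial) cubes. For a polytope $P$, $\mathcal{C}(P)$ is the complex of all faces of $P$ (including $\emptyset$ and $P$) and $\mathcal{C}(\partial P)$ the complex of all proper faces; for a finite collection of polytopes, $\mathcal{C}(\{P_1,\dots,P_m\})=\mathcal{C}(P_1\cup\cdots\cup P_m)=\bigcup_i\mathcal{C}(P_i)$ (having no faces at all if the collection is empty). If $\mathcal{D}$ is a subcomplex of $\mathcal{C}$, $\mathcal{C}\setminus\mathcal{D}=\{P\in\mathcal{C}:P\notin\mathcal{D}\}$ is a relative complex. A shelling of a pure $d$-dimensional polytopal complex is a linear ordering $(F_1,\ldots,F_s)$ of its facets such that either $d=0$, or (1) $\mathcal{C}(\partial F_1)$ has a shelling, and (2) for $2\le j\le s$, $F_j\cap\bigcup_{i<j}F_i$ is nonempty and equals $G_1\cup\cdots\cup G_r$ for some shelling $(G_1,\ldots,G_r,\ldots,G_t)$ of $\mathcal{C}(\partial F_j)$ and some $r\in[t]$. For a polytope $P$, let $L(P)$ be its face lattice, $[F,P]$ the closed interval of faces containing $F$, ${}^\ast$ the dual poset, and $A(\cdot)$ the set of atoms of a poset with a least element. Thus $A([F,P]^\ast)$ is the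 set of facets of $P$ containing $F$ (empty if $F=P$, all facets if $F=\emptyset$), and $A(L(P)^\ast)$ is the set of all facets. The reciprocal domains associated to a face $F$ of $P$ are $$\mathcal{C}(P)\setminus\mathcal{C}(A([F,P]^\ast))\quad\text{and}\quad \mathcal{C}(P)\setminus\mathcal{C}(A(L(P)^\ast)\setminus A([F,P]^\ast)).$$ A relative complex is stable if it is isomorphic to one of the reciprocal domains associated to some face $F$ (possibly $\emptyset$ or $P$) of some polytope $P$; here $\mathcal{C}\setminus\mathcal{D}$ and $\mathcal{C}'\setminus\mathcal{D}'$ are isomorphic if there is an inclusion-preserving (both ways) bijection $\mathcal{C}\to\mathcal{C}'$ mapping $\mathcal{D}$ onto $\mathcal{D}'$. A shelling $(F_1,\ldots,F_s)$ of $\mathcal{C}$ is stable if for all $i\in[s]$ the relative complex $\mathcal{R}_i=\mathcal{C}(F_i)\setminus\mathcal{C}(F_1\cup\cdots\cup F_{i-1})$, viewed as $\mathcal{C}(F_i)$ minus its subcomplex $\mathcal{C}(F_i)\cap\bigcup_{k<i}\mathcal{C}(F_k)$, is stable. The barycentric subdivision $\mathrm{sd}(\mathcal{C})$ is the simplicial complex whose $k$-dimensional faces are the sets $\{F_0,\ldots,F_k\}$ of faces of $\mathcal{C}$ with $\emptyset\subsetneq F_0\subsetneq F_1\subsetneq\cdots\subsetneq F_k$ (together with the empty face). For an $(m-1)$-dimensional complex $\mathcal{K}$, $f(\mathcal{K};x)=\sum_{k=-1}^{m-1}f_k(\mathcal{K})x^{k+1}$, where $f_k$ is the number of $k$-dimensional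 faces ($f_{-1}=1$), and $h(\mathcal{K};x)=(1-x)^m f(\mathcal{K};\frac{x}{1-x})$. A real polynomial is real-rooted if it is identically zero or has only real zeros. *)

theory Defs
  imports "HOL-Analysis.Analysis" "HOL-Analysis.Finite_Function_Topology" "HOL-Computational_Algebra.Polynomial"
begin

section \<open>Polytopes and face lattices\<close>

text \<open>
  Convex polytopes live in the space of finitely supported real sequences. It contains a copy of
  every Euclidean space, and every polytope spans only finitely many dimensions, so these are all
  convex polytopes (of all dimensions) up to affine isomorphism.
\<close>
type_synonym point = "(nat, real) poly_mapping"

definition face_lattice :: "point set \<Rightarrow> point set set" where
  "face_lattice P = {F. F face_of P}"

text \<open>The standard cube \<open>[0,1]\<^sup>d\<close>, in the first \<open>d\<close> coordinates.\<close>
definition std_cube :: "nat \<Rightarrow> point set" where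
  "std_cube d = {x. (\<forall>i<d. 0 \<le> Poly_Mapping.lookup x i \<and> Poly_Mapping.lookup x i \<le> 1) \<and> (\<forall>i\<ge>d. Poly_Mapping.lookup x i = 0)}"

definition order_isomorphism :: "('a set \<Rightarrow> 'b set) \<Rightarrow> 'a set set \<Rightarrow> 'b set set \<Rightarrow> bool" where
  "order_isomorphism \<phi> K L \<longleftrightarrow>
     bij_betw \<phi> K L \<and> (\<forall>X\<in>K. \<forall>Y\<in>K. X \<subseteq> Y \<longleftrightarrow> \<phi> X \<subseteq> \<phi> Y)"

definition order_isomorphic :: "'a set set \<Rightarrow> 'b set set \<Rightarrow> bool" where
  "order_isomorphic K L \<longleftrightarrow> (\<exists>\<phi>. order_isomorphism \<phi> K L)"


section \<open>Polytopal and cubical complexes\<close>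

text \<open>
  A complex is a collection \<open>K\<close> of sets ordered by inclusion. A member may be thought of as the
  vertex set of an abstract polytope, or as the point set of a geometric one; in either case its
  faces are the members of \<open>K\<close> contained in it. \<open>faces_in K P\<close> is thus the complex \<open>C(P)\<close> and
  \<open>boundary_in K P\<close> the complex \<open>C(\<partial>P)\<close>.
\<close>
definition faces_in :: "'a set set \<Rightarrow> 'a set \<Rightarrow> 'a set set" where
  "faces_in K P = {G \<in> K. G \<subseteq> P}"

definition boundary_in :: "'a set set \<Rightarrow> 'a set \<Rightarrow> 'a set set" where
  "boundary_in K P = {G \<in> K. G \<subset> P}"

text \<open>
  Closure under taking faces is part of the third condition: \<open>K\<close> contains below \<open>P\<close> an
  entire face lattice of a polytope. In the last condition \<open>P \<inter> Q\<close>, being a member of \<open>K\<close>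
  contained in \<open>P\<close> and in \<open>Q\<close>, is a common face of both.
\<close>
definition polytopal_complex :: "'a set set \<Rightarrow> bool" where
  "polytopal_complex K \<longleftrightarrow>
     finite K \<and> {} \<in> K \<and>
     (\<forall>P\<in>K. \<exists>Q. polytope Q \<and> order_isomorphic (faces_in K P) (face_lattice Q)) \<and>
     (\<forall>P\<in>K. \<forall>Q\<in>K. P \<inter> Q \<in> K)"

definition facets :: "'a set set \<Rightarrow> 'a set set" where
  "facets K = {F \<in> K. \<forall>G\<in>K. F \<subseteq> G \<longrightarrow> G = F}"

text \<open>
  The dimension of an abstract polytope is the rank of its face lattice minus one, the rank being
  the maximal number of members of a chain of proper faces (counting the empty face).
\<close>
definition face_dim :: "'a set set \<Rightarrow> 'a set \<Rightarrow> int" where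
  "face_dim K P = int (Max (card ` chains (boundary_in K P))) - 1"

definition pure_of_dim :: "int \<Rightarrow> 'a set set \<Rightarrow> bool" where
  "pure_of_dim d K \<longleftrightarrow> (\<forall>F\<in>facets K. face_dim K F = d)"

definition cubical_complex :: "'a set set \<Rightarrow> bool" where
  "cubical_complex K \<longleftrightarrow>
     polytopal_complex K \<and>
     (\<forall>F\<in>facets K. \<exists>d. order_isomorphic (faces_in K F) (face_lattice (std_cube d)))"


section \<open>Shellings\<close>

text \<open>
  Unions and intersections of polytopes in the definition of a shelling are those of the
  associated complexes. \<open>attaching_complex K Fs j\<close> is \<open>C(F\<^sub>j) \<inter> \<Union>\<^sub>i\<^sub><\<^sub>j C(F\<^sub>i)\<close>; it is nonempty as a
  union of polytopes iff it is not just \<open>{\<emptyset>}\<close>. List indices start at \<open>0\<close>.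
\<close>
definition attaching_complex :: "'a set set \<Rightarrow> 'a set list \<Rightarrow> nat \<Rightarrow> 'a set set" where
  "attaching_complex K Fs j = faces_in K (Fs ! j) \<inter> (\<Union>i<j. faces_in K (Fs ! i))"

inductive shelling :: "'a set set \<Rightarrow> 'a set list \<Rightarrow> bool" where
  "\<lbrakk> polytopal_complex K; pure_of_dim d K; distinct Fs; set Fs = facets K;
     d = 0 \<or>
     (\<exists>Gs. shelling (boundary_in K (Fs ! 0)) Gs) \<and>
     (\<forall>j. 1 \<le> j \<and> j < length Fs \<longrightarrow>
        attaching_complex K Fs j \<noteq> {{}} \<and>
        (\<exists>Gs r. shelling (boundary_in K (Fs ! j)) Gs \<and> 1 \<le> r \<and> r \<le> length Gs \<and>
           attaching_complex K Fs j = (\<Union>k<r. faces_in K (Gs ! k)))) \<rbrakk>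
   \<Longrightarrow> shelling K Fs"


section \<open>Stable relative complexes and stable shellings\<close>

text \<open>
  A relative complex \<open>C \<setminus> D\<close> is represented by the pair \<open>C\<close>, \<open>D\<close>, since isomorphism depends on
  both.
\<close>
definition relative_isomorphic ::
    "'a set set \<Rightarrow> 'a set set \<Rightarrow> 'b set set \<Rightarrow> 'b set set \<Rightarrow> bool" where
  "relative_isomorphic C D C' D' \<longleftrightarrow> (\<exists>\<phi>. order_isomorphism \<phi> C C' \<and> \<phi> ` D = D')"

text \<open>
  \<open>coatoms_above P F\<close> is \<open>A([F,P]\<^sup>*)\<close>: the maximal elements of \<open>[F,P]\<close> without \<open>P\<close>. The empty
  face \<open>F = {}\<close> gives \<open>A(L(P)\<^sup>*)\<close>.
\<close>
definition coatoms_above :: "point set \<Rightarrow> point set \<Rightarrow> point set set" where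
  "coatoms_above P F = facets {G \<in> face_lattice P. F \<subseteq> G \<and> G \<noteq> P}"

definition stable :: "'a set set \<Rightarrow> 'a set set \<Rightarrow> bool" where
  "stable C D \<longleftrightarrow>
     (\<exists>P F. polytope P \<and> F \<in> face_lattice P \<and>
        (relative_isomorphic C D
           (face_lattice P) (\<Union>G \<in> coatoms_above P F. face_lattice G) \<or>
         relative_isomorphic C D
           (face_lattice P) (\<Union>G \<in> coatoms_above P {} - coatoms_above P F. face_lattice G)))"

definition stable_shelling :: "'a set set \<Rightarrow> 'a set list \<Rightarrow> bool" where
  "stable_shelling K Fs \<longleftrightarrow>
     shelling K Fs \<and>
     (\<forall>i<length Fs. stable (faces_in K (Fs ! i)) (attaching_complex K Fs i))"


section \<open>Barycentric subdivision and h-polynomial\<close>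

text \<open>The simplices are the chains of nonempty faces, including the empty chain.\<close>
definition sd :: "'a set set \<Rightarrow> 'a set set set" where
  "sd K = chains (K - {{}})"

text \<open>
  For a finite simplicial complex, \<open>f_count S j\<close> is \<open>f\<^sub>j\<^sub>-\<^sub>1\<close> and \<open>top_card S\<close> is the dimension
  plus one.
\<close>
definition f_count :: "'v set set \<Rightarrow> nat \<Rightarrow> nat" where
  "f_count S j = card {\<sigma> \<in> S. card \<sigma> = j}"

definition top_card :: "'v set set \<Rightarrow> nat" where
  "top_card S = Max (card ` S)"

definition f_poly :: "'v set set \<Rightarrow> real poly" where
  "f_poly S = (\<Sum>j\<le>top_card S. monom (real (f_count S j)) j)"

text \<open>
  The polynomial obtained from \<open>(1 - x)\<^sup>m f(x / (1 - x))\<close> by clearing denominators; see the lemma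
  below.
\<close>
definition h_poly :: "'v set set \<Rightarrow> real poly" where
  "h_poly S = (\<Sum>j\<le>top_card S. monom (real (f_count S j)) j * [:1, -1:] ^ (top_card S - j))"

lemma poly_h_poly:
  assumes "x \<noteq> 1"
  shows "poly (h_poly S) x = (1 - x) ^ top_card S * poly (f_poly S) (x / (1 - x))"
proof -
  have "real (f_count S j) * x ^ j * (1 - x) ^ (top_card S - j) =
        (1 - x) ^ top_card S * (real (f_count S j) * (x / (1 - x)) ^ j)"
    if "j \<le> top_card S" for j
    using that assms by (simp add: power_diff power_divide)
  then have "(\<Sum>j\<le>top_card S. real (f_count S j) * x ^ j * (1 - x) ^ (top_card S - j)) =
        (\<Sum>j\<le>top_card S. (1 - x) ^ top_card S * (real (f_count S j) * (x / (1 - x)) ^ j))"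
    by (intro sum.cong) auto
  then show ?thesis
    by (simp add: h_poly_def f_poly_def poly_sum poly_monom sum_distrib_left)
qed

definition real_rooted :: "real poly \<Rightarrow> bool" where
  "real_rooted p \<longleftrightarrow> p = 0 \<or> (\<forall>z::complex. poly (map_poly of_real p) z = 0 \<longrightarrow> z \<in> \<real>)"

end

theory Submission
  imports Defs
begin

text \<open>
  Fix \<open>z\<close> in the open upper half-plane and put \<open>y = z / (1 - z)\<close>. Up to a power of \<open>1 - z\<close>, the
  value at \<open>z\<close> of the h-polynomial is the sum of \<open>y ^ card \<sigma>\<close> over all chains \<open>\<sigma>\<close> of nonempty
  faces. Sorting the chains by the first facet that contains their maximum splits this sum along the
  shelling into contributions of stable relative complexes on a \<open>d\<close>-cube. Such a complex is the
  cube minus \<open>s\<close> facets through a common face of codimension \<open>s\<close>, or minus the complement of such a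
  set of facets; counting its faces by dimension gives \<open>(1 + t)\<^sup>s (2 + t)\<^sup>d\<^sup>-\<^sup>s\<close>, respectively
  \<open>t\<^sup>d\<^sup>-\<^sup>s (1 + t)\<^sup>s\<close>. Hence there are only \<open>2 d + 2\<close> possible contributions. Ordered suitably, they
  satisfy the recursion \<open>g\<^sub>k = x (f\<^sub>0 + \<dots> + f\<^sub>k\<^sub>-\<^sub>1) + f\<^sub>k + \<dots> + f\<^sub>n\<^sub>-\<^sub>1\<close> from dimension \<open>d\<close> to \<open>d + 1\<close>,
  which preserves interlacing, and sums of members of an interlacing family are real-rooted.
  Interlacing is only used through the signs of \<open>Im (f\<^sub>j(z) cnj (f\<^sub>i(z)))\<close> and
  \<open>Im (z f\<^sub>i(z) cnj (f\<^sub>j(z)))\<close> for \<open>i < j\<close>, so that no zeros have to be located.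
\<close>

section \<open>Interlacing at a point of the upper half-plane\<close>

text \<open>
  For interlacing polynomials \<open>f\<close>, \<open>g\<close> with nonnegative coefficients, these are the two
  properties of the values \<open>a = f(z)\<close>, \<open>b = g(z)\<close> at a point \<open>z\<close> of the upper half-plane: both
  \<open>g / f\<close> and \<open>x f / g\<close> map the upper half-plane to its closure.
\<close>
definition interlaces_at :: "complex \<Rightarrow> complex \<Rightarrow> complex \<Rightarrow> bool" where
  "interlaces_at z a b \<longleftrightarrow> 0 \<le> Im (b * cnj a) \<and> 0 \<le> Im (z * a * cnj b)"

definition interlacing_at :: "complex \<Rightarrow> nat \<Rightarrow> (nat \<Rightarrow> complex) \<Rightarrow> bool" where
  "interlacing_at z n f \<longleftrightarrow>
     (\<forall>i<n. f i \<noteq> 0) \<and> (\<forall>j<n. \<forall>i<j. interlaces_at z (f i) (f j))"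

lemma interlaces_at_self:
  assumes "0 \<le> Im z"
  shows "interlaces_at z a a"
proof -
  have "Im (z * a * cnj a) = Im z * (cmod a)\<^sup>2"
    unfolding cmod_power2 by (simp add: algebra_simps power2_eq_square)
  then show ?thesis
    using assms by (simp add: interlaces_at_def)
qed

text \<open>Both imaginary parts scale by \<open>(cmod c)\<^sup>2\<close>, so a common factor such
  as a power of \<open>1 - z\<close> does not affect interlacing.\<close>

lemma interlaces_at_mult:
  assumes "interlaces_at z a b"
  shows "interlaces_at z (c * a) (c * b)"
proof -
  have "Im (c * b * cnj (c * a)) = (cmod c)\<^sup>2 * Im (b * cnj a)"
    "Im (z * (c * a) * cnj (c * b)) = (cmod c)\<^sup>2 * Im (z * a * cnj b)"
    unfolding cmod_power2 by (simp_all add: algebra_simps power2_eq_square)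
  then show ?thesis
    using assms by (simp add: interlaces_at_def)
qed

text \<open>Both imaginary parts are additive in either argument, so the inequalities for the pairs
  of summands add up.\<close>

lemma interlaces_at_sum:
  assumes "\<And>i j. i \<in> A \<Longrightarrow> j \<in> B \<Longrightarrow> interlaces_at z (f i) (g j)"
  shows "interlaces_at z (sum f A) (sum g B)"
proof -
  have "Im (sum g B * cnj (sum f A)) = (\<Sum>j\<in>B. \<Sum>i\<in>A. Im (g j * cnj (f i)))"
    by (simp only: cnj_sum sum_product Im_sum)
  moreover have "Im (z * sum f A * cnj (sum g B)) = (\<Sum>i\<in>A. \<Sum>j\<in>B. Im (z * f i * cnj (g j)))"
    by (simp only: cnj_sum sum_product sum_distrib_left[of z] Im_sum)
  ultimately show ?thesis
    using assms unfolding interlaces_at_def by (auto intro!: sum_nonneg)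
qed

text \<open>If \<open>b = - a\<close>, the second quantity would be
  \<open>- Im z * (cmod a)\<^sup>2\<close>, which is negative.\<close>

lemma interlaces_at_add_nonzero:
  assumes "0 < Im z" "interlaces_at z a b" "a \<noteq> 0"
  shows "a + b \<noteq> 0"
proof
  assume "a + b = 0"
  then have "b = - a"
    by (simp add: add_eq_0_iff)
  then have "Im (z * a * cnj b) = - (Im z * (cmod a)\<^sup>2)"
    by (simp add: cmod_power2) (simp add: algebra_simps power2_eq_square)
  then show False
    using assms by (simp add: interlaces_at_def mult_le_0_iff)
qed

text \<open>A summand of least index interlaces the sum of all the others, so the two cannot cancel.
  Since \<open>k\<close> may take a value several times, any nonempty multiset of members is
  covered.\<close>

lemma interlacing_at_sum_nonzero:
  assumes "0 < Im z" "interlacing_at z n f" "finite S" "S \<noteq> {}" "\<And>i. i \<in> S \<Longrightarrow> k i < n"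
  shows "(\<Sum>i\<in>S. f (k i)) \<noteq> 0"
proof -
  obtain i where i: "i \<in> S" "\<And>j. j \<in> S \<Longrightarrow> k i \<le> k j"
    using assms(3,4) by (metis ex_min_if_finite arg_min_if_finite(1) arg_min_least)
  have "interlaces_at z (f (k i)) (f (k j))" if "j \<in> S" for j
    using i(1) i(2)[OF that] assms(2) assms(5)[OF that] interlaces_at_self[of z "f (k i)"] assms(1)
    by (cases "k i = k j") (auto simp: interlacing_at_def)
  then have "interlaces_at z (f (k i)) (\<Sum>j\<in>S - {i}. f (k j))"
    using interlaces_at_sum[of "{i}" "S - {i}" z "f \<circ> k" "f \<circ> k"] by simp
  then have "f (k i) + (\<Sum>j\<in>S - {i}. f (k j)) \<noteq> 0"
    using assms i(1) by (intro interlaces_at_add_nonzero) (auto simp: interlacing_at_def)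
  then show ?thesis
    using assms(3) i(1) by (simp add: sum.remove)
qed

text \<open>
  The recursion \<open>g\<^sub>k = x (f\<^sub>0 + \<dots> + f\<^sub>k\<^sub>-\<^sub>1) + f\<^sub>k + \<dots> + f\<^sub>n\<^sub>-\<^sub>1\<close>.
  With \<open>a\<close>, \<open>b\<close>, \<open>c\<close> the sums of the \<open>f\<^sub>j\<close> over \<open>j < k\<close>, \<open>k \<le> j < l\<close> and \<open>l \<le> j\<close>, the only part of
  \<open>Im (z g\<^sub>k cnj g\<^sub>l)\<close> that is not a nonnegative combination of the assumed quantities is
  \<open>Im z |z a + c|\<^sup>2\<close>.
\<close>
lemma interlaces_at_recursion:
  assumes z: "0 < Im z"
    and ab: "interlaces_at z a b" and ac: "interlaces_at z a c" and bc: "interlaces_at z b c"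
  shows "interlaces_at z (z * a + b + c) (z * a + z * b + c)"
proof -
  have "Im ((z * a + z * b + c) * cnj (z * a + b + c)) =
      Im (z * a * cnj b) + (cmod z)\<^sup>2 * Im (b * cnj a) + Im z * (cmod b)\<^sup>2 +
      Im (z * b * cnj c) + Im (c * cnj b)"
    unfolding cmod_power2 by (simp add: algebra_simps power2_eq_square)
  moreover have "Im (z * (z * a + b + c) * cnj (z * a + z * b + c)) =
      Im z * (cmod (z * a + c))\<^sup>2 + (cmod z)\<^sup>2 * Im (z * a * cnj b) +
      (cmod z)\<^sup>2 * Im (b * cnj a) + Im (z * b * cnj c) + (cmod z)\<^sup>2 * Im (c * cnj b)"
    unfolding cmod_power2 by (simp add: algebra_simps power2_eq_square)
  ultimately show ?thesis
    using z assms by (simp add: interlaces_at_def)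
qed

text \<open>The factor \<open>c\<close> absorbs the normalisation: the members are values of
  polynomials divided by a power of \<open>1 - z\<close>, and each dimension adds one such
  factor.\<close>

lemma interlacing_at_recursion:
  assumes z: "0 < Im z" and f: "interlacing_at z n f" and n: "0 < n" and c: "c \<noteq> 0"
    and g: "\<And>k. k \<le> n \<Longrightarrow> c * g k = z * sum f {..<k} + sum f {k..<n}"
  shows "interlacing_at z (Suc n) g"
proof -
  have il: "interlaces_at z (sum f {i..<j}) (sum f {j'..<k})" if "j \<le> j'" "k \<le> n" for i j j' k
    using that f by (intro interlaces_at_sum) (auto simp: interlacing_at_def)
  have nz: "sum f {i..<j} \<noteq> 0" if "i < j" "j \<le> n" for i j
    using interlacing_at_sum_nonzero[OF z f, of "{i..<j}" "\<lambda>i. i"] that by auto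
  show ?thesis
    unfolding interlacing_at_def
  proof (intro conjI allI impI)
    fix k assume "k < Suc n"
    then have k: "k \<le> n" by simp
    have "z * sum f {0..<k} + sum f {k..<n} \<noteq> 0"
    proof (cases "k = 0")
      case True
      then show ?thesis using nz[of 0 n] n by simp
    next
      case False
      then have nz0: "sum f {0..<k} \<noteq> 0" using nz[of 0 k] k by simp
      show ?thesis
      proof
        \<comment> \<open>With \<open>a\<close> and \<open>b\<close> the two partial sums,
          \<open>b = - z * a\<close> gives \<open>Im (b * cnj a) < 0\<close>, although
          \<open>a\<close> interlaces \<open>b\<close>.\<close>
        assume "z * sum f {0..<k} + sum f {k..<n} = 0"
        then have "sum f {k..<n} = - (z * sum f {0..<k})"
          by (simp add: add_eq_0_iff)
        moreover have "Im (- (z * w) * cnj w) = - (Im z * (cmod w)\<^sup>2)" for w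
          unfolding cmod_power2 by (simp add: algebra_simps power2_eq_square)
        ultimately have "Im (sum f {k..<n} * cnj (sum f {0..<k})) =
            - (Im z * (cmod (sum f {0..<k}))\<^sup>2)"
          by metis
        then show False
          using il[of k k n 0] nz0 z by (simp add: interlaces_at_def mult_le_0_iff)
      qed
    qed
    then show "g k \<noteq> 0"
      using g[OF k] by (auto simp: atLeast0LessThan)
  next
    fix l k assume "l < Suc n" "k < l"
    then have kl: "k < l" "l \<le> n" by auto
    \<comment> \<open>Only the middle block changes its factor, from \<open>1\<close> to
      \<open>z\<close>, between \<open>g k\<close> and \<open>g l\<close>.\<close>
    let ?a = "sum f {0..<k}" and ?b = "sum f {k..<l}" and ?c = "sum f {l..<n}"
    have "sum f {..<l} = ?a + ?b" "sum f {k..<n} = ?b + ?c" "sum f {..<k} = ?a"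
      using kl by (simp_all add: sum.atLeastLessThan_concat flip: atLeast0LessThan)
    then have "c * g k = z * ?a + ?b + ?c" "c * g l = z * ?a + z * ?b + ?c"
      using g[of k] g[of l] kl by (simp_all only: distrib_left add.assoc)
    then have "interlaces_at z (c * g k) (c * g l)"
      using interlaces_at_recursion[OF z, of ?a ?b ?c] il kl by simp
    then have "interlaces_at z (inverse c * (c * g k)) (inverse c * (c * g l))"
      by (rule interlaces_at_mult)
    then show "interlaces_at z (g k) (g l)"
      using c by (simp add: mult.assoc[symmetric])
  qed
qed

text \<open>Members may be omitted or repeated as long as the order is kept; a repeated member
  interlaces itself.\<close>

lemma interlacing_at_reindex:
  assumes "0 \<le> Im z" "interlacing_at z n f" "\<And>i. i < m \<Longrightarrow> k i < n"
    and "\<And>i j. i < j \<Longrightarrow> j < m \<Longrightarrow> k i \<le> k j"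
  shows "interlacing_at z m (\<lambda>i. f (k i))"
  unfolding interlacing_at_def
proof (intro conjI allI impI)
  fix i j assume ij: "j < m" "i < j"
  then show "interlaces_at z (f (k i)) (f (k j))"
    using assms(2) assms(3)[of j] assms(4)[of i j] interlaces_at_self[OF assms(1)]
    by (cases "k i = k j") (auto simp: interlacing_at_def)
qed (use assms in \<open>auto simp: interlacing_at_def\<close>)

section \<open>The h-polynomials of stable relative complexes on cubes\<close>

text \<open>
  The sum of \<open>y ^ card \<sigma>\<close> over the chains \<open>\<sigma>\<close> of nonempty faces of the \<open>k\<close>-cube with maximum the
  cube itself.
\<close>
fun cube_chain_sum :: "complex \<Rightarrow> nat \<Rightarrow> complex" where
  "cube_chain_sum y k =
     y * (1 + (\<Sum>j<k. of_nat (k choose j) * 2 ^ (k - j) * cube_chain_sum y j))"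

declare cube_chain_sum.simps [simp del]

text \<open>
  The linear functional \<open>t ^ k \<mapsto> cube_chain_sum y k\<close>. It turns the polynomial that enumerates faces
  of a cube by dimension into the sum of \<open>y ^ card \<sigma>\<close> over the chains with maximum among these
  faces.
\<close>
definition chain_functional :: "complex \<Rightarrow> complex poly \<Rightarrow> complex" where
  "chain_functional y p = (\<Sum>k\<le>degree p. coeff p k * cube_chain_sum y k)"

text \<open>A common summation range for several polynomials makes the linearity of the functional
  visible.\<close>

lemma chain_functional_bound:
  assumes "degree p \<le> n"
  shows "chain_functional y p = (\<Sum>k\<le>n. coeff p k * cube_chain_sum y k)"
  unfolding chain_functional_def
  using assms by (intro sum.mono_neutral_left) (auto simp: coeff_eq_0)

lemma chain_functional_0 [simp]: "chain_functional y 0 = 0"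
  by (simp add: chain_functional_def)

lemma chain_functional_add:
  "chain_functional y (p + q) = chain_functional y p + chain_functional y q"
proof -
  let ?n = "max (degree p) (degree q)"
  have "degree (p + q) \<le> ?n"
    by (rule degree_add_le_max)
  then show ?thesis
    by (simp add: chain_functional_bound[of _ ?n] sum.distrib algebra_simps)
qed

lemma chain_functional_sum:
  "chain_functional y (sum f A) = (\<Sum>x\<in>A. chain_functional y (f x))"
  by (induction A rule: infinite_finite_induct) (simp_all add: chain_functional_add)

lemma chain_functional_monom [simp]: "chain_functional y (monom 1 k) = cube_chain_sum y k"
  by (simp add: chain_functional_def degree_monom_eq if_distrib[of "\<lambda>c. c * _"] cong: if_cong)

text \<open>The coefficients of \<open>(2 + t) ^ k\<close> count the nonempty faces of the
  \<open>k\<close>-cube by dimension, and subtracting \<open>t ^ k\<close> leaves the proper ones.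
  The summand \<open>1\<close> is the chain consisting of the cube alone.\<close>

lemma cube_chain_sum_eq:
  "cube_chain_sum y k = y * (1 + chain_functional y ([:2, 1:] ^ k - monom 1 k))"
proof -
  have "chain_functional y ([:2, 1:] ^ k) =
      chain_functional y ([:2, 1:] ^ k - monom 1 k) + cube_chain_sum y k"
    using chain_functional_add[of y "[:2, 1:] ^ k - monom 1 k" "monom 1 k"] by simp
  moreover have "chain_functional y ([:2, 1:] ^ k) =
      (\<Sum>j\<le>k. of_nat (k choose j) * 2 ^ (k - j) * cube_chain_sum y j)"
    by (simp add: chain_functional_def degree_linear_power coeff_linear_poly_power)
  ultimately have "chain_functional y ([:2, 1:] ^ k - monom 1 k) =
      (\<Sum>j<k. of_nat (k choose j) * 2 ^ (k - j) * cube_chain_sum y j)"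
    by (simp add: lessThan_Suc_atMost[symmetric])
  then show ?thesis
    by (simp add: cube_chain_sum.simps[of y k])
qed

text \<open>
  For \<open>y = z / (1 - z)\<close> these are the values at \<open>z\<close>, divided by \<open>(1 - z) ^ (d + 1)\<close>, of the
  h-polynomials of the \<open>d\<close>-cube without \<open>s\<close> facets of which no two are opposite, respectively
  without \<open>s\<close> pairs of opposite facets and one facet of each other pair. In the first case the
  summand \<open>1\<close> comes from the empty chain, which is present only if no facet is removed.
\<close>
definition stable_value :: "complex \<Rightarrow> nat \<Rightarrow> nat \<Rightarrow> complex" where
  "stable_value y d s =
     chain_functional y ([:1, 1:] ^ s * [:2, 1:] ^ (d - s)) + (if s = 0 then 1 else 0)"

definition stable_value' :: "complex \<Rightarrow> nat \<Rightarrow> nat \<Rightarrow> complex" where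
  "stable_value' y d s = chain_functional y ([:0, 1:] ^ s * [:1, 1:] ^ (d - s))"

text \<open>The order of the list is the one in which the values interlace. For \<open>d > 0\<close>
  the entries at \<open>d\<close> and \<open>Suc d\<close> coincide, both coming from
  \<open>(1 + t) ^ d\<close>.\<close>

definition stable_values :: "complex \<Rightarrow> nat \<Rightarrow> nat \<Rightarrow> complex" where
  "stable_values y d j = (if j \<le> d then stable_value y d j else stable_value' y d (j - Suc d))"

text \<open>Algebraically this is \<open>2 + t = (1 + t) + 1\<close>. Geometrically, the next facet
  to be removed is a \<open>d\<close>-cube that already lacks \<open>s\<close> of its own facets;
  for \<open>s = 0\<close> it takes the empty chain with it.\<close>

lemma stable_value_step:
  assumes "s \<le> d"
  shows "stable_value y (Suc d) s = stable_value y (Suc d) (Suc s) + stable_value y d s"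
proof -
  have *: "a * (p * c) = (q * a) * c + a * c" if "p = q + 1" for a c p q :: "complex poly"
    unfolding that by (simp add: algebra_simps)
  have "[:1, 1:] ^ s * [:2 :: complex, 1:] ^ (Suc d - s) =
      [:1, 1:] ^ Suc s * [:2, 1:] ^ (d - s) + [:1, 1:] ^ s * [:2, 1:] ^ (d - s)"
    unfolding Suc_diff_le[OF assms] power_Suc by (rule *) (simp add: one_pCons)
  then show ?thesis
    by (simp add: stable_value_def chain_functional_add)
qed

text \<open>The same removal of one facet, now opposite to a facet removed before:
  \<open>1 + t = t + 1\<close>.\<close>

lemma stable_value'_step:
  assumes "s \<le> d"
  shows "stable_value' y (Suc d) s = stable_value' y (Suc d) (Suc s) + stable_value' y d s"
proof -
  have *: "a * (p * c) = (q * a) * c + a * c" if "p = q + 1" for a c p q :: "complex poly"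
    unfolding that by (simp add: algebra_simps)
  have "[:0, 1:] ^ s * [:1 :: complex, 1:] ^ (Suc d - s) =
      [:0, 1:] ^ Suc s * [:1, 1:] ^ (d - s) + [:0, 1:] ^ s * [:1, 1:] ^ (d - s)"
    unfolding Suc_diff_le[OF assms] power_Suc by (rule *) (simp add: one_pCons)
  then show ?thesis
    by (simp add: stable_value'_def chain_functional_add)
qed

text \<open>The left-hand side sums over the chains ending in the full \<open>(d + 1)\<close>-cube.
  Their other members form chains in its boundary, and the \<open>2 * d + 2\<close> summands are
  what its facets add in a shelling: first \<open>d + 1\<close> facets through a vertex, then their
  opposites. The telescoping sums express this decomposition.\<close>

lemma stable_value'_last:
  "stable_value' y (Suc d) (Suc d) = y * (\<Sum>j<2 * d + 2. stable_values y d j)"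
proof -
  have tele: "a ^ Suc d - b ^ Suc d = (\<Sum>s\<le>d. b ^ s * a ^ (d - s))"
    if "a = b + 1" for a b :: "complex poly"
    using diff_power_eq_sum[of b d a] that
    by (simp add: lessThan_Suc_atMost[symmetric] algebra_simps)
  have "(\<Sum>j<2 * d + 2. stable_values y d j) =
      (\<Sum>j<Suc d. stable_values y d j) + (\<Sum>j<Suc d. stable_values y d (j + Suc d))"
    using sum.atLeastLessThan_concat[of 0 "Suc d" "Suc d + Suc d" "stable_values y d"]
      sum.shift_bounds_nat_ivl[of "stable_values y d" 0 "Suc d" "Suc d"]
    by (simp add: atLeast0LessThan mult_2)
  also have "(\<Sum>j<Suc d. stable_values y d j) =
      1 + (\<Sum>s\<le>d. chain_functional y ([:1, 1:] ^ s * [:2, 1:] ^ (d - s)))"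
    by (simp add: lessThan_Suc_atMost stable_values_def stable_value_def sum.distrib sum.delta)
  also have "\<dots> = 1 + chain_functional y ([:2, 1:] ^ Suc d - [:1, 1:] ^ Suc d)"
    by (subst tele) (simp_all add: one_pCons chain_functional_sum)
  also have "(\<Sum>j<Suc d. stable_values y d (j + Suc d)) =
      (\<Sum>s\<le>d. chain_functional y ([:0, 1:] ^ s * [:1, 1:] ^ (d - s)))"
    by (simp add: lessThan_Suc_atMost stable_values_def stable_value'_def)
  also have "\<dots> = chain_functional y ([:1, 1:] ^ Suc d - [:0, 1:] ^ Suc d)"
    by (subst tele) (simp_all add: one_pCons chain_functional_sum)
  finally have sum_eq: "(\<Sum>j<2 * d + 2. stable_values y d j) =
      1 + chain_functional y ([:2, 1:] ^ Suc d - [:0, 1:] ^ Suc d)"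
    by (simp add: add.assoc del: power_Suc flip: chain_functional_add)
  have pow: "[:0, 1:] ^ Suc d = monom (1 :: complex) (Suc d)"
    by (simp add: monom_altdef del: power_Suc)
  have "stable_value' y (Suc d) (Suc d) = chain_functional y ([:0, 1:] ^ Suc d)"
    by (simp add: stable_value'_def del: power_Suc)
  also have "\<dots> = y * (\<Sum>j<2 * d + 2. stable_values y d j)"
    unfolding sum_eq unfolding pow chain_functional_monom by (rule cube_chain_sum_eq)
  finally show ?thesis .
qed

lemma interlacing_at_stable_values:
  assumes z: "0 < Im z"
  shows "interlacing_at z (2 * d + 2) (stable_values (z / (1 - z)) d)"
proof (induction d)
  case 0
  define y where "y = z / (1 - z)"
  have z1: "1 - z \<noteq> 0" "z \<noteq> 0"
    using z by auto
  \<comment> \<open>In dimension \<open>0\<close> the two values are \<open>1\<close> and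
    \<open>z\<close> up to the common factor \<open>1 / (1 - z)\<close>.\<close>
  have "1 + y = inverse (1 - z) * 1" "y = inverse (1 - z) * z"
    using z1 by (simp_all add: y_def field_simps)
  moreover have "interlaces_at z 1 z"
    using z by (simp add: interlaces_at_def)
  ultimately have "interlaces_at z (1 + y) y" "1 + y \<noteq> 0" "y \<noteq> 0"
    using interlaces_at_mult[of z 1 z "inverse (1 - z)"] z1 by simp_all
  moreover have "stable_values y 0 0 = 1 + y" "stable_values y 0 (Suc 0) = y"
    by (simp_all add: stable_values_def stable_value_def stable_value'_def chain_functional_def
        cube_chain_sum.simps[of _ 0])
  ultimately show ?case
    by (auto simp: interlacing_at_def less_Suc_eq y_def[symmetric] numeral_2_eq_2)
next
  case (Suc d)
  define y where "y = z / (1 - z)"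
  have z1: "1 - z \<noteq> 0"
    using z by auto
  let ?n = "2 * d + 2"
  \<comment> \<open>In dimension \<open>Suc d\<close> the entries at \<open>Suc d\<close> and
    \<open>Suc (Suc d)\<close> are equal. Listing this value once leaves \<open>2 * d + 3\<close>
    entries, the number that the recursion produces from \<open>2 * d + 2\<close>.\<close>
  define g where "g k = stable_values y (Suc d) (if k \<le> Suc d then k else Suc k)" for k
  have g_step: "g k = g (Suc k) + stable_values y d k" if "k < ?n" for k
  proof -
    consider "k \<le> d" | "k = Suc d" | "Suc d < k" by linarith
    then show ?thesis
    proof cases
      case 1
      then show ?thesis
        using stable_value_step[of k d y] by (simp add: g_def stable_values_def)
    next
      case 2
      have "g k = stable_value' y (Suc d) 0"
        by (simp add: 2 g_def stable_values_def stable_value_def stable_value'_def)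
      then show ?thesis
        using stable_value'_step[of 0 d y] by (simp add: 2 g_def stable_values_def)
    next
      case 3
      then have "Suc (k - Suc d) = k - d" by simp
      then show ?thesis
        using stable_value'_step[of "k - Suc d" d y] that 3 by (simp add: g_def stable_values_def)
    qed
  qed
  \<comment> \<open>Downward induction: the last entry is \<open>y\<close> times the full sum, and
    each step down adds one member of dimension \<open>d\<close>.\<close>
  have g_eq: "g k = y * sum (stable_values y d) {..<?n} + sum (stable_values y d) {k..<?n}"
    if "k \<le> ?n" for k
    using that
  proof (induction rule: inc_induct)
    case base
    show ?case
      using stable_value'_last[of y d] by (simp add: g_def stable_values_def)
  next
    case (step k)
    then show ?case
      using g_step[of k] sum.atLeast_Suc_lessThan[of k ?n "stable_values y d"]
      by (simp only: add.assoc add.commute[of "stable_values y d k"])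
  qed
  \<comment> \<open>Since \<open>(1 - z) * y = z\<close>, the part \<open>- z * B\<close> cancels
    the upper half of the full sum and leaves \<open>z\<close> only on the indices below
    \<open>k\<close>.\<close>
  have y: "(1 - z) * (y * A + B) = z * A + (1 - z) * B" for A B
    using z1 by (simp add: y_def field_simps)
  have "(1 - z) * g k = z * sum (stable_values y d) {..<k} + sum (stable_values y d) {k..<?n}"
    if "k \<le> ?n" for k
  proof -
    have split: "sum (stable_values y d) {..<?n} =
        sum (stable_values y d) {..<k} + sum (stable_values y d) {k..<?n}"
      using sum.atLeastLessThan_concat[of 0 k ?n "stable_values y d"] that
      by (simp only: atLeast0LessThan)
    show ?thesis
      unfolding g_eq[OF that] y unfolding split by (simp only: left_diff_distrib distrib_left) simp
  qed
  then have "interlacing_at z (Suc ?n) g"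
    using Suc z z1 unfolding y_def[symmetric]
    by (intro interlacing_at_recursion[where f = "stable_values y d" and c = "1 - z"]) auto
  \<comment> \<open>The duplicate entry is reinserted.\<close>
  then have "interlacing_at z (2 * Suc d + 2) (\<lambda>i. g (if i \<le> Suc d then i else i - 1))"
    using z by (intro interlacing_at_reindex[where n = "Suc ?n" and f = g
          and k = "\<lambda>i. if i \<le> Suc d then i else i - 1"]) auto
  moreover have "g (if i \<le> Suc d then i else i - 1) = stable_values y (Suc d) i" for i
    by (cases "i = Suc (Suc d)")
      (auto simp: g_def stable_values_def stable_value_def stable_value'_def)
  ultimately show ?case
    by (simp add: y_def)
qed

section \<open>Face lattices of cubes\<close>

definition cube_faces :: "nat \<Rightarrow> (nat \<Rightarrow> bool set) set" where
  "cube_faces d = PiE {..<d} (\<lambda>_. UNIV - {{}})"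

definition free_dim :: "nat \<Rightarrow> (nat \<Rightarrow> bool set) \<Rightarrow> nat" where
  "free_dim d \<phi> = card {i \<in> {..<d}. \<phi> i = UNIV}"

text \<open>
  A nonempty face of the \<open>d\<close>-cube is given by a nonempty set of admissible end points in each
  coordinate; \<open>UNIV\<close> marks the coordinates that are free on the face. \<open>cube_param d L \<beta>\<close> says that
  \<open>L\<close> is isomorphic via \<open>\<beta>\<close> to the face lattice of the \<open>d\<close>-cube.
\<close>
definition cube_param :: "nat \<Rightarrow> 'a set set \<Rightarrow> ((nat \<Rightarrow> bool set) \<Rightarrow> 'a set) \<Rightarrow> bool" where
  "cube_param d L \<beta> \<longleftrightarrow>
     {} \<in> L \<and> bij_betw \<beta> (cube_faces d) (L - {{}}) \<and>
     (\<forall>\<phi>\<in>cube_faces d. \<forall>\<psi>\<in>cube_faces d. \<beta> \<phi> \<subseteq> \<beta> \<psi> \<longleftrightarrow> (\<forall>i<d. \<phi> i \<subseteq> \<psi> i))"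

lemma bool_set_singleton:
  fixes s :: "bool set"
  assumes "s \<noteq> {}" "s \<noteq> UNIV"
  obtains b where "s = {b}"
proof -
  have "s \<in> {{}, {False}, {True}, UNIV}"
    unfolding UNIV_bool using Pow_UNIV[where 'a = bool] unfolding UNIV_bool Pow_insert by auto
  then show ?thesis
    using assms that by blast
qed

lemma singleton_bool_neq_UNIV: "{e} \<noteq> (UNIV :: bool set)"
proof
  assume "{e} = UNIV"
  then have "\<not> e \<in> {e}"
    by (metis UNIV_I singletonD)
  then show False
    by simp
qed

lemma finite_cube_faces: "finite (cube_faces d)"
  by (simp add: cube_faces_def finite_PiE)

lemma cube_faces_nonempty: "\<phi> \<in> cube_faces d \<Longrightarrow> i < d \<Longrightarrow> \<phi> i \<noteq> {}"
  by (auto simp: cube_faces_def PiE_iff)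

lemma cube_faces_eqI:
  assumes "\<phi> \<in> cube_faces d" "\<psi> \<in> cube_faces d" "\<And>i. i < d \<Longrightarrow> \<phi> i = \<psi> i"
  shows "\<phi> = \<psi>"
  using assms unfolding cube_faces_def by (intro PiE_ext[of _ "{..<d}"]) auto

text \<open>Where the two faces differ, the larger one must be free, because a singleton has no
  smaller nonempty subset.\<close>

lemma free_dim_less:
  assumes "\<And>i. i < d \<Longrightarrow> \<psi> i \<subseteq> \<phi> i" "\<phi> \<in> cube_faces d" "\<psi> \<in> cube_faces d" "\<psi> \<noteq> \<phi>"
  shows "free_dim d \<psi> < free_dim d \<phi>"
  unfolding free_dim_def
proof (rule psubset_card_mono)
  obtain i where i: "i < d" "\<psi> i \<noteq> \<phi> i"
    using assms(2-4) cube_faces_eqI by blast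
  have "\<phi> i = UNIV"
  proof (rule ccontr)
    assume "\<phi> i \<noteq> UNIV"
    then obtain b where "\<phi> i = {b}"
      using bool_set_singleton cube_faces_nonempty[OF assms(2) i(1)] by metis
    then show False
      using i assms(1)[OF i(1)] cube_faces_nonempty[OF assms(3) i(1)] by (metis subset_singletonD)
  qed
  moreover from this have "\<psi> i \<noteq> UNIV"
    using i(2) by metis
  ultimately show "{i \<in> {..<d}. \<psi> i = UNIV} \<subset> {i \<in> {..<d}. \<phi> i = UNIV}"
    using i(1) assms(1) by auto
qed simp

text \<open>The factor contributed by one coordinate to \<open>t ^ free_dim d \<phi>\<close>, which
  makes face enumerators factor over the coordinates.\<close>

definition end_point_weight :: "bool set \<Rightarrow> complex poly" where
  "end_point_weight s = (if s = UNIV then [:0, 1:] else 1)"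

lemma sum_end_point_weight: "(\<Sum>s | s \<noteq> {}. end_point_weight s) = [:2, 1:]"
proof -
  have "{s. s \<noteq> {}} = Pow UNIV - {{}}"
    by blast
  also have "\<dots> = {{True}, {False}, UNIV :: bool set}"
    by (auto simp: UNIV_bool Pow_insert)
  finally show ?thesis
    using singleton_bool_neq_UNIV by (simp add: end_point_weight_def one_pCons)
qed

lemma sum_end_point_weight_remove: "(\<Sum>s | s \<noteq> {} \<and> s \<noteq> {b}. end_point_weight s) = [:1, 1:]"
proof -
  have "{s. s \<noteq> {} \<and> s \<noteq> {b}} = {s. s \<noteq> {}} - {{b}}"
    by blast
  then have "(\<Sum>s | s \<noteq> {} \<and> s \<noteq> {b}. end_point_weight s) =
      (\<Sum>s | s \<noteq> {}. end_point_weight s) - end_point_weight {b}"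
    by (simp add: sum_diff1)
  also have "\<dots> = [:1, 1:]"
    using singleton_bool_neq_UNIV[of b]
    unfolding sum_end_point_weight by (simp add: end_point_weight_def one_pCons)
  finally show ?thesis .
qed

lemma sum_monom_free_dim:
  "(\<Sum>\<phi>\<in>PiE {..<d} B. monom 1 (free_dim d \<phi>)) = (\<Prod>i<d. \<Sum>s\<in>B i. end_point_weight s)"
proof -
  have "monom 1 (free_dim d \<phi>) = (\<Prod>i<d. end_point_weight (\<phi> i))" for \<phi>
    by (simp add: free_dim_def end_point_weight_def prod.If_cases monom_altdef Int_def)
  then show ?thesis
    by (simp add: prod_sum_PiE)
qed

text \<open>A free coordinate of \<open>\<phi>\<close> offers two end points and the whole interval,
  hence \<open>2 + t\<close>; a fixed coordinate offers no choice, hence \<open>1\<close>.\<close>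

lemma sum_monom_below:
  assumes "\<phi> \<in> cube_faces d"
  shows "(\<Sum>\<psi> | \<psi> \<in> cube_faces d \<and> (\<forall>i<d. \<psi> i \<subseteq> \<phi> i). monom (1 :: complex) (free_dim d \<psi>)) =
    [:2, 1:] ^ free_dim d \<phi>"
proof -
  have "{\<psi> \<in> cube_faces d. \<forall>i<d. \<psi> i \<subseteq> \<phi> i} = PiE {..<d} (\<lambda>i. Pow (\<phi> i) - {{}})"
    by (auto simp: cube_faces_def PiE_iff extensional_def)
  moreover have "(\<Sum>s\<in>Pow (\<phi> i) - {{}}. end_point_weight s) =
      (if \<phi> i = UNIV then [:2, 1:] else 1)" if i: "i < d" for i
  proof (cases "\<phi> i = UNIV")
    case True
    have "Pow UNIV - {{}} = {s :: bool set. s \<noteq> {}}"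
      by blast
    then show ?thesis
      using True by (simp only: sum_end_point_weight refl if_True)
  next
    case False
    then obtain b where b: "\<phi> i = {b}"
      using bool_set_singleton[OF cube_faces_nonempty[OF assms i]] by metis
    have "Pow (\<phi> i) - {{}} = {{b}}"
      unfolding b by blast
    then show ?thesis
      using False by (simp add: b end_point_weight_def)
  qed
  ultimately show ?thesis
    by (simp add: sum_monom_free_dim prod.If_cases Int_def) (simp add: free_dim_def)
qed

section \<open>Parametrised cube lattices and order isomorphisms\<close>

lemma cube_param_face_nonempty:
  assumes "cube_param d L \<beta>" "\<phi> \<in> cube_faces d"
  shows "\<beta> \<phi> \<in> L" "\<beta> \<phi> \<noteq> {}"
  using assms by (auto simp: cube_param_def bij_betw_def)

lemma cube_param_face_cases:
  assumes "cube_param d L \<beta>" "X \<in> L" "X \<noteq> {}"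
  obtains \<phi> where "\<phi> \<in> cube_faces d" "X = \<beta> \<phi>"
proof -
  have "X \<in> \<beta> ` cube_faces d"
    using assms by (simp add: cube_param_def bij_betw_def)
  then show ?thesis
    using that by blast
qed

lemma cube_param_subset_iff:
  assumes "cube_param d L \<beta>" "\<phi> \<in> cube_faces d" "\<psi> \<in> cube_faces d"
  shows "\<beta> \<phi> \<subseteq> \<beta> \<psi> \<longleftrightarrow> (\<forall>i<d. \<phi> i \<subseteq> \<psi> i)"
  using assms by (simp add: cube_param_def)

lemma cube_param_inj: "cube_param d L \<beta> \<Longrightarrow> inj_on \<beta> (cube_faces d)"
  by (simp add: cube_param_def bij_betw_def)

lemma cube_param_finite:
  assumes "cube_param d L \<beta>"
  shows "finite L"
proof -
  have "L - {{}} = \<beta> ` cube_faces d"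
    using assms by (simp add: cube_param_def bij_betw_def)
  then show ?thesis
    using finite_cube_faces by (metis finite_imageI finite_insert finite_Diff2 finite.emptyI)
qed

lemma order_isomorphism_empty:
  assumes "order_isomorphism \<phi> L L'" "{} \<in> L" "{} \<in> L'"
  shows "\<phi> {} = {}"
proof -
  obtain X where "X \<in> L" "\<phi> X = {}"
    using assms by (auto simp: order_isomorphism_def bij_betw_def image_iff)
  moreover have "\<phi> {} \<subseteq> \<phi> X"
    using assms(1,2) \<open>X \<in> L\<close> unfolding order_isomorphism_def by blast
  ultimately show ?thesis
    by simp
qed

lemma cube_param_transfer:
  assumes \<beta>: "cube_param d L \<beta>" and f: "order_isomorphism f L L'" and L': "{} \<in> L'"
  shows "cube_param d L' (f \<circ> \<beta>)"
proof -
  have L: "{} \<in> L" and bij: "bij_betw \<beta> (cube_faces d) (L - {{}})"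
    using \<beta> by (auto simp: cube_param_def)
  have "bij_betw f (L - {{}}) (L' - {f {}})"
    using f L bij_betwE[of f L L']
    by (auto simp: order_isomorphism_def intro!: bij_betw_DiffI bij_betw_singletonI)
  then have "bij_betw f (L - {{}}) (L' - {{}})"
    using order_isomorphism_empty[OF f L L'] by simp
  then have "bij_betw (f \<circ> \<beta>) (cube_faces d) (L' - {{}})"
    by (rule bij_betw_trans[OF bij])
  moreover have "f (\<beta> \<phi>) \<subseteq> f (\<beta> \<psi>) \<longleftrightarrow> (\<forall>i<d. \<phi> i \<subseteq> \<psi> i)"
    if "\<phi> \<in> cube_faces d" "\<psi> \<in> cube_faces d" for \<phi> \<psi>
    using cube_param_subset_iff[OF \<beta> that] cube_param_face_nonempty[OF \<beta>] that f
    by (auto simp: order_isomorphism_def)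
  ultimately show ?thesis
    using L' by (simp add: cube_param_def)
qed

lemma order_isomorphism_inv:
  assumes "order_isomorphism f L L'"
  shows "order_isomorphism (inv_into L f) L' L"
proof -
  have f: "bij_betw f L L'" "\<And>X Y. X \<in> L \<Longrightarrow> Y \<in> L \<Longrightarrow> X \<subseteq> Y \<longleftrightarrow> f X \<subseteq> f Y"
    using assms by (auto simp: order_isomorphism_def)
  have "X \<subseteq> Y \<longleftrightarrow> inv_into L f X \<subseteq> inv_into L f Y" if "X \<in> L'" "Y \<in> L'" for X Y
  proof -
    have "inv_into L f X \<in> L" "inv_into L f Y \<in> L" "f (inv_into L f X) = X" "f (inv_into L f Y) = Y"
      using f(1) that by (auto simp: bij_betw_def inv_into_into f_inv_into_f)
    then show ?thesis
      using f(2) by metis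
  qed
  then show ?thesis
    using f(1) by (simp add: order_isomorphism_def bij_betw_inv_into)
qed

definition full_face :: "nat \<Rightarrow> nat \<Rightarrow> bool set" where
  "full_face d = (\<lambda>i\<in>{..<d}. UNIV)"

lemma full_face_in_cube_faces: "full_face d \<in> cube_faces d"
  unfolding full_face_def cube_faces_def by (rule restrict_PiE_iff[THEN iffD2]) simp

lemma full_face_apply: "i < d \<Longrightarrow> full_face d i = UNIV"
  by (simp add: full_face_def)

lemma cube_param_full_face:
  assumes \<beta>: "cube_param d L \<beta>" and T: "T \<in> L" "\<And>X. X \<in> L \<Longrightarrow> X \<subseteq> T"
  shows "\<beta> (full_face d) = T"
proof
  note full = full_face_in_cube_faces[of d]
  show "\<beta> (full_face d) \<subseteq> T"
    using cube_param_face_nonempty[OF \<beta> full] T(2) by blast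
  then have "T \<noteq> {}"
    using cube_param_face_nonempty[OF \<beta> full] by blast
  then obtain \<phi> where "\<phi> \<in> cube_faces d" "T = \<beta> \<phi>"
    using cube_param_face_cases[OF \<beta> T(1)] by metis
  then show "T \<subseteq> \<beta> (full_face d)"
    using cube_param_subset_iff[OF \<beta> _ full, of \<phi>] by (simp add: full_face_apply)
qed

section \<open>Chains of faces\<close>

definition top_chains :: "'a set set \<Rightarrow> 'a set \<Rightarrow> 'a set set set" where
  "top_chains K G = {\<sigma> \<in> chains (K - {{}}). G \<in> \<sigma> \<and> (\<forall>X\<in>\<sigma>. X \<subseteq> G)}"

lemma finite_chains: "finite K \<Longrightarrow> finite (chains K)"
  by (rule finite_subset[of _ "Pow K"]) (auto simp: chains_def)

lemma finite_top_chains: "finite K \<Longrightarrow> finite (top_chains K G)"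
  by (simp add: top_chains_def finite_chains)

lemma finite_chain_has_max:
  assumes "chain_subset \<sigma>" "finite \<sigma>" "\<sigma> \<noteq> {}"
  obtains G where "G \<in> \<sigma>" "\<And>X. X \<in> \<sigma> \<Longrightarrow> X \<subseteq> G"
proof -
  obtain G where G: "G \<in> \<sigma>" "\<And>X. X \<in> \<sigma> \<Longrightarrow> G \<subseteq> X \<Longrightarrow> G = X"
    using finite_has_maximal[OF assms(2,3)] by metis
  have "X \<subseteq> G" if "X \<in> \<sigma>" for X
    using assms(1) G that unfolding chain_subset_def by metis
  then show ?thesis
    using G(1) that by metis
qed

text \<open>Only faces below \<open>G\<close> can occur in such a chain, so the ambient complex may
  be exchanged for a boundary or for a single facet.\<close>

lemma top_chains_cong:
  assumes "faces_in K G = faces_in K' G"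
  shows "top_chains K G = top_chains K' G"
proof -
  have "\<sigma> \<subseteq> K - {{}} \<longleftrightarrow> \<sigma> \<subseteq> K' - {{}}" if "\<forall>X\<in>\<sigma>. X \<subseteq> G" for \<sigma>
    using assms that unfolding faces_in_def by blast
  then show ?thesis
    unfolding top_chains_def chains_def mem_Collect_eq by (metis (lifting))
qed

text \<open>Nonempty chains are sorted by their maximum; the empty chain gives the
  \<open>1\<close>.\<close>

lemma sum_chains:
  fixes y :: "'b :: comm_semiring_1"
  assumes "finite K"
  shows "(\<Sum>\<sigma>\<in>chains (K - {{}}). y ^ card \<sigma>) =
    1 + (\<Sum>G\<in>K - {{}}. \<Sum>\<sigma>\<in>top_chains K G. y ^ card \<sigma>)"
proof -
  have "chains (K - {{}}) = insert {} (\<Union>G\<in>K - {{}}. top_chains K G)"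
  proof (intro set_eqI iffI)
    fix \<sigma> assume \<sigma>: "\<sigma> \<in> chains (K - {{}})"
    show "\<sigma> \<in> insert {} (\<Union>G\<in>K - {{}}. top_chains K G)"
    proof (cases "\<sigma> = {}")
      case False
      have "chain_subset \<sigma>" "\<sigma> \<subseteq> K - {{}}"
        using \<sigma> by (simp_all add: chains_def)
      moreover from this have "finite \<sigma>"
        using assms finite_subset by blast
      ultimately obtain G where "G \<in> \<sigma>" "\<And>X. X \<in> \<sigma> \<Longrightarrow> X \<subseteq> G"
        using finite_chain_has_max[of \<sigma>] False by metis
      then have "\<sigma> \<in> top_chains K G" "G \<in> K - {{}}"
        using \<sigma> \<open>\<sigma> \<subseteq> K - {{}}\<close> by (auto simp: top_chains_def)
      then show ?thesis
        by blast
    qed simp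
  qed (auto simp: top_chains_def chains_def chain_subset_def)
  moreover have "{} \<notin> (\<Union>G\<in>K - {{}}. top_chains K G)"
    by (auto simp: top_chains_def)
  moreover have "(\<Sum>\<sigma>\<in>(\<Union>G\<in>K - {{}}. top_chains K G). y ^ card \<sigma>) =
      (\<Sum>G\<in>K - {{}}. \<Sum>\<sigma>\<in>top_chains K G. y ^ card \<sigma>)"
    using assms finite_top_chains
    by (intro sum.UNION_disjoint) (auto simp: top_chains_def)
  ultimately show ?thesis
    using assms finite_top_chains[of K] by simp
qed

text \<open>Deleting the maximum is a bijection onto the chains of nonempty proper faces and lowers
  the cardinality by one.\<close>

lemma sum_top_chains:
  fixes y :: "'b :: comm_semiring_1"
  assumes "finite K" "G \<in> K" "G \<noteq> {}"
  shows "(\<Sum>\<sigma>\<in>top_chains K G. y ^ card \<sigma>) =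
    y * (\<Sum>\<sigma>\<in>chains (boundary_in K G - {{}}). y ^ card \<sigma>)"
proof -
  let ?B = "chains (boundary_in K G - {{}})"
  have notin: "G \<notin> \<sigma>" and sub: "\<sigma> \<subseteq> K" if "\<sigma> \<in> ?B" for \<sigma>
    using that by (auto simp: chains_def boundary_in_def)
  have fin: "finite \<sigma>" if "\<sigma> \<in> ?B" for \<sigma>
    using sub[OF that] assms(1) by (rule finite_subset)
  have "top_chains K G = insert G ` ?B"
  proof (intro set_eqI iffI)
    fix \<sigma> assume \<sigma>: "\<sigma> \<in> top_chains K G"
    then have "\<sigma> - {G} \<in> ?B"
      by (auto simp: top_chains_def chains_def boundary_in_def chain_subset_def)
    moreover have "insert G (\<sigma> - {G}) = \<sigma>"
      using \<sigma> by (auto simp: top_chains_def)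
    ultimately show "\<sigma> \<in> insert G ` ?B"
      by (metis image_eqI)
  next
    fix \<sigma> assume "\<sigma> \<in> insert G ` ?B"
    then show "\<sigma> \<in> top_chains K G"
      using assms(2,3) by (auto simp: top_chains_def chains_def boundary_in_def chain_subset_def)
  qed
  moreover have "inj_on (insert G) ?B"
    using notin by (auto simp: inj_on_def insert_ident)
  ultimately have "(\<Sum>\<sigma>\<in>top_chains K G. y ^ card \<sigma>) = (\<Sum>\<sigma>\<in>?B. y ^ card (insert G \<sigma>))"
    by (simp add: sum.reindex)
  also have "\<dots> = (\<Sum>\<sigma>\<in>?B. y * y ^ card \<sigma>)"
    using notin fin by (intro sum.cong) auto
  finally show ?thesis
    by (simp add: sum_distrib_left)
qed

text \<open>Induction on the dimension of the face: its boundary consists of smaller cubes, whose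
  enumerator is \<open>(2 + t) ^ k - t ^ k\<close>, so the chain sums obey the recursion defining
  \<open>cube_chain_sum\<close>.\<close>

lemma sum_top_chains_cube:
  assumes \<beta>: "cube_param d L \<beta>" and "\<phi> \<in> cube_faces d"
  shows "(\<Sum>\<sigma>\<in>top_chains L (\<beta> \<phi>). y ^ card \<sigma>) = cube_chain_sum y (free_dim d \<phi>)"
  using assms(2)
proof (induction "free_dim d \<phi>" arbitrary: \<phi> rule: less_induct)
  case less
  let ?A = "{\<psi> \<in> cube_faces d. \<forall>i<d. \<psi> i \<subseteq> \<phi> i}"
  have fin: "finite L"
    using cube_param_finite[OF \<beta>] .
  have bd: "boundary_in L (\<beta> \<phi>) - {{}} = \<beta> ` (?A - {\<phi>})"
  proof (intro set_eqI iffI)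
    fix X assume "X \<in> boundary_in L (\<beta> \<phi>) - {{}}"
    then have X: "X \<in> L" "X \<noteq> {}" "X \<subseteq> \<beta> \<phi>" "X \<noteq> \<beta> \<phi>"
      by (auto simp: boundary_in_def)
    then obtain \<psi> where \<psi>: "\<psi> \<in> cube_faces d" "X = \<beta> \<psi>"
      using cube_param_face_cases[OF \<beta>] by metis
    then show "X \<in> \<beta> ` (?A - {\<phi>})"
      using X cube_param_subset_iff[OF \<beta> \<psi>(1) less.prems] by auto
  next
    fix X assume "X \<in> \<beta> ` (?A - {\<phi>})"
    then obtain \<psi> where \<psi>: "X = \<beta> \<psi>" "\<psi> \<in> ?A" "\<psi> \<noteq> \<phi>" by auto
    then show "X \<in> boundary_in L (\<beta> \<phi>) - {{}}"
      using cube_param_subset_iff[OF \<beta> _ less.prems, of \<psi>] cube_param_face_nonempty[OF \<beta>, of \<psi>]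
        inj_onD[OF cube_param_inj[OF \<beta>], of \<psi> \<phi>] less.prems
      by (auto simp: boundary_in_def)
  qed
  have finB: "finite (boundary_in L (\<beta> \<phi>))"
    using fin by (simp add: boundary_in_def)
  have finA: "finite ?A"
    using finite_cube_faces by simp
  have tc: "top_chains (boundary_in L (\<beta> \<phi>)) (\<beta> \<psi>) = top_chains L (\<beta> \<psi>)" if "\<psi> \<in> ?A - {\<phi>}" for \<psi>
  proof (rule top_chains_cong)
    have "\<beta> \<psi> \<in> boundary_in L (\<beta> \<phi>)"
      using that bd by blast
    then show "faces_in (boundary_in L (\<beta> \<phi>)) (\<beta> \<psi>) = faces_in L (\<beta> \<psi>)"
      by (auto simp: faces_in_def boundary_in_def)
  qed
  have "(\<Sum>\<sigma>\<in>chains (boundary_in L (\<beta> \<phi>) - {{}}). y ^ card \<sigma>) =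
      1 + (\<Sum>G\<in>\<beta> ` (?A - {\<phi>}). \<Sum>\<sigma>\<in>top_chains (boundary_in L (\<beta> \<phi>)) G. y ^ card \<sigma>)"
    using sum_chains[OF finB, of y] unfolding bd .
  also have "\<dots> = 1 + (\<Sum>\<psi>\<in>?A - {\<phi>}. \<Sum>\<sigma>\<in>top_chains (boundary_in L (\<beta> \<phi>)) (\<beta> \<psi>). y ^ card \<sigma>)"
    using inj_on_subset[OF cube_param_inj[OF \<beta>], of "?A - {\<phi>}"] by (subst sum.reindex) auto
  also have "\<dots> = 1 + (\<Sum>\<psi>\<in>?A - {\<phi>}. cube_chain_sum y (free_dim d \<psi>))"
    using tc less.hyps free_dim_less[of d _ \<phi>] less.prems
    by (intro arg_cong2[of _ _ _ _ "(+)"] sum.cong) auto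
  also have "\<dots> = 1 + chain_functional y (\<Sum>\<psi>\<in>?A - {\<phi>}. monom 1 (free_dim d \<psi>))"
    by (simp add: chain_functional_sum)
  also have "(\<Sum>\<psi>\<in>?A - {\<phi>}. monom 1 (free_dim d \<psi>)) =
      [:2, 1 :: complex:] ^ free_dim d \<phi> - monom 1 (free_dim d \<phi>)"
    using sum_monom_below[OF less.prems] finA less.prems by (subst sum_diff1) auto
  finally show ?case
    using sum_top_chains[OF fin cube_param_face_nonempty[OF \<beta> less.prems], of y]
      cube_chain_sum_eq[of y "free_dim d \<phi>"] by simp
qed

text \<open>A strictly increasing rank function bounds the length of chains from above, and an
  explicit flag attains the bound.\<close>

lemma face_dim_cube:
  assumes \<beta>: "cube_param d (faces_in K F) \<beta>" and F: "F \<in> K"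
  shows "face_dim K F = int d"
proof -
  let ?L = "faces_in K F"
  have F_eq: "F = \<beta> (full_face d)"
    by (rule sym, rule cube_param_full_face[OF \<beta>]) (use F in \<open>simp_all add: faces_in_def\<close>)
  have fin: "finite (boundary_in K F)"
    using cube_param_finite[OF \<beta>] by (rule rev_finite_subset) (auto simp: boundary_in_def faces_in_def)
  \<comment> \<open>Ranks are shifted by one to leave \<open>0\<close> for the empty face.\<close>
  define r where "r X = (if X = {} then 0 else Suc (free_dim d (inv_into (cube_faces d) \<beta> X)))" for X
  have r_\<beta>: "r (\<beta> \<phi>) = Suc (free_dim d \<phi>)" if "\<phi> \<in> cube_faces d" for \<phi>
    using that cube_param_face_nonempty[OF \<beta> that] cube_param_inj[OF \<beta>] by (simp add: r_def)
  have r_less: "r X < r Y" if XY: "X \<in> ?L" "Y \<in> ?L" "X \<subset> Y" for X Y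
  proof -
    have "Y \<noteq> {}" using XY by auto
    then obtain \<psi> where \<psi>: "\<psi> \<in> cube_faces d" "Y = \<beta> \<psi>"
      using cube_param_face_cases[OF \<beta> XY(2)] by metis
    show ?thesis
    proof (cases "X = {}")
      case True
      then show ?thesis using r_\<beta> \<psi> by (simp add: r_def)
    next
      case False
      then obtain \<phi> where \<phi>: "\<phi> \<in> cube_faces d" "X = \<beta> \<phi>"
        using cube_param_face_cases[OF \<beta> XY(1)] by metis
      then show ?thesis
        using r_\<beta> \<psi> XY(3) cube_param_subset_iff[OF \<beta> \<phi>(1) \<psi>(1)] free_dim_less[of d \<phi> \<psi>] by auto
    qed
  qed
  have r_full: "r F = Suc d"
    using r_\<beta>[OF full_face_in_cube_faces] by (simp add: F_eq free_dim_def full_face_apply cong: conj_cong)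
  have "card \<sigma> \<le> Suc d" if \<sigma>: "\<sigma> \<in> chains (boundary_in K F)" for \<sigma>
  proof -
    have sub: "X \<in> ?L \<and> X \<subset> F" if "X \<in> \<sigma>" for X
      using \<sigma> that by (auto simp: chains_def boundary_in_def faces_in_def)
    have "inj_on r \<sigma>"
    proof (rule inj_onI)
      fix X Y assume XY: "X \<in> \<sigma>" "Y \<in> \<sigma>" "r X = r Y"
      then have "X \<subseteq> Y \<or> Y \<subseteq> X"
        using \<sigma> by (auto simp: chains_def chain_subset_def)
      then show "X = Y"
        using r_less[of X Y] r_less[of Y X] sub XY by (metis less_irrefl psubsetI)
    qed
    moreover have "r ` \<sigma> \<subseteq> {..<Suc d}"
      using r_less[of _ F] sub F r_full by (auto simp: faces_in_def)
    ultimately show ?thesis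
      using card_inj_on_le[of r \<sigma> "{..<Suc d}"] by simp
  qed
  moreover have "\<exists>\<sigma>\<in>chains (boundary_in K F). card \<sigma> = Suc d"
  proof -
    \<comment> \<open>The flag: free in the first \<open>j\<close> coordinates, \<open>1\<close> in
      the rest. The \<open>d\<close> faces with \<open>j < d\<close> and the empty face form
      \<open>Suc d\<close> proper faces.\<close>
    define \<phi> where "\<phi> j = (\<lambda>i\<in>{..<d}. if i < j then UNIV else {True})" for j
    have \<phi>: "\<phi> j \<in> cube_faces d" for j
      by (simp add: \<phi>_def cube_faces_def)
    have le: "\<beta> (\<phi> j) \<subseteq> \<beta> (\<phi> k)" if "j \<le> k" for j k
      using that cube_param_subset_iff[OF \<beta> \<phi> \<phi>] by (auto simp: \<phi>_def)
    have free: "free_dim d (\<phi> j) = j" if "j \<le> d" for j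
    proof -
      have "{True} \<noteq> UNIV" by auto
      then have "{i \<in> {..<d}. \<phi> j i = UNIV} = {..<j}"
        using that by (auto simp: \<phi>_def split: if_splits)
      then show ?thesis by (simp add: free_dim_def)
    qed
    have "inj_on (\<lambda>j. \<beta> (\<phi> j)) {..<d}"
      by (rule inj_onI) (metis free \<phi> r_\<beta> lessThan_iff less_imp_le_nat nat.inject)
    moreover have ne: "{} \<notin> (\<lambda>j. \<beta> (\<phi> j)) ` {..<d}"
      using cube_param_face_nonempty[OF \<beta> \<phi>] by auto
    ultimately have "card (insert {} ((\<lambda>j. \<beta> (\<phi> j)) ` {..<d})) = Suc d"
      by (simp add: card_image)
    moreover have "\<beta> (\<phi> j) \<in> boundary_in K F" if "j < d" for j
    proof -
      have "r (\<beta> (\<phi> j)) \<noteq> r F"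
        using r_\<beta>[OF \<phi>, of j] free[of j] that r_full by simp
      then show ?thesis
        using cube_param_face_nonempty[OF \<beta> \<phi>, of j] by (auto simp: boundary_in_def faces_in_def)
    qed
    moreover have "{} \<in> boundary_in K F"
      using \<beta> cube_param_face_nonempty[OF \<beta> full_face_in_cube_faces] F_eq
      by (auto simp: boundary_in_def faces_in_def cube_param_def)
    moreover have "\<beta> (\<phi> j) \<subseteq> \<beta> (\<phi> k) \<or> \<beta> (\<phi> k) \<subseteq> \<beta> (\<phi> j)" for j k
      using le[of j k] le[of k j] by linarith
    ultimately show ?thesis
      by (intro bexI[of _ "insert {} ((\<lambda>j. \<beta> (\<phi> j)) ` {..<d})"])
        (auto simp: chains_def chain_subset_def)
  qed
  ultimately have "Max (card ` chains (boundary_in K F)) = Suc d"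
    using finite_chains[OF fin] by (intro Max_eqI) (auto intro: rev_image_eqI)
  then show ?thesis
    by (simp add: face_dim_def)
qed

section \<open>The faces of the standard cube\<close>

lemma lookup_scaleR [simp]:
  "Poly_Mapping.lookup (c *\<^sub>R x) i = c *\<^sub>R Poly_Mapping.lookup x i"
proof -
  have "finite {i. c *\<^sub>R Poly_Mapping.lookup x i \<noteq> 0}"
    by (rule finite_subset[OF _ finite_lookup]) auto
  then show ?thesis
    by (simp add: scaleR_poly_mapping_def)
qed

text \<open>
  Whether a point with coordinate \<open>t \<in> [0, 1]\<close> forces the end point \<open>e\<close> (\<open>True\<close> for \<open>1\<close>, \<open>False\<close>
  for \<open>0\<close>) to be admissible on every face containing it.
\<close>
definition toward :: "bool \<Rightarrow> real \<Rightarrow> bool" where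
  "toward e t \<longleftrightarrow> (if e then 0 < t else t < 1)"

text \<open>With \<phi> i = {e} the condition pins coordinate \<open>i\<close> to the end point
  \<open>e\<close>, since any other value is \<open>toward\<close> the opposite end; with
  \<open>UNIV\<close> it is void.\<close>

definition std_face :: "nat \<Rightarrow> (nat \<Rightarrow> bool set) \<Rightarrow> point set" where
  "std_face d \<phi> = {x \<in> std_cube d. \<forall>i<d. \<forall>e. toward e (Poly_Mapping.lookup x i) \<longrightarrow> e \<in> \<phi> i}"

lemma std_cube_coord:
  "x \<in> std_cube d \<Longrightarrow> 0 \<le> Poly_Mapping.lookup x i \<and> Poly_Mapping.lookup x i \<le> 1"
  by (cases "i < d") (auto simp: std_cube_def)

text \<open>A combination with positive weights of nonnegative numbers is positive iff one of them
  is; this is applied to the distances from the end point opposite to \<open>e\<close>.\<close>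

lemma toward_convex_comb_iff:
  fixes a b u :: real
  assumes "0 \<le> a" "a \<le> 1" "0 \<le> b" "b \<le> 1" "0 < u" "u < 1"
  shows "toward e ((1 - u) * a + u * b) \<longleftrightarrow> toward e a \<or> toward e b"
proof (cases e)
  case True
  have "0 \<le> (1 - u) * a" "0 \<le> u * b" "0 < (1 - u) * a \<longleftrightarrow> 0 < a" "0 < u * b \<longleftrightarrow> 0 < b"
    using assms by (simp_all add: zero_less_mult_iff)
  then show ?thesis
    using True by (auto simp: toward_def)
next
  case False
  have "0 \<le> (1 - u) * (1 - a)" "0 \<le> u * (1 - b)"
    "0 < (1 - u) * (1 - a) \<longleftrightarrow> a < 1" "0 < u * (1 - b) \<longleftrightarrow> b < 1"
    using assms by (simp_all add: zero_less_mult_iff)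
  moreover have "1 - ((1 - u) * a + u * b) = (1 - u) * (1 - a) + u * (1 - b)"
    by (simp add: algebra_simps)
  ultimately show ?thesis
    using False by (auto simp: toward_def)
qed

lemma convex_std_cube: "convex (std_cube d)"
proof (rule convexI)
  fix x y :: point and u v :: real
  assume xy: "x \<in> std_cube d" "y \<in> std_cube d" and uv: "0 \<le> u" "0 \<le> v" "u + v = 1"
  have "0 \<le> u * a + v * b \<and> u * a + v * b \<le> 1" if "0 \<le> a \<and> a \<le> 1" "0 \<le> b \<and> b \<le> 1" for a b :: real
    using that uv convex_bound_le[of a 1 b u v] by simp
  then show "u *\<^sub>R x + v *\<^sub>R y \<in> std_cube d"
    using xy uv unfolding std_cube_def by (simp add: lookup_add)
qed

lemma toward_comb:
  assumes "a \<in> std_cube d" "b \<in> std_cube d" "0 < u" "u < 1"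
  shows "toward e (Poly_Mapping.lookup ((1 - u) *\<^sub>R a + u *\<^sub>R b) i) \<longleftrightarrow>
    toward e (Poly_Mapping.lookup a i) \<or> toward e (Poly_Mapping.lookup b i)"
  using toward_convex_comb_iff[of "Poly_Mapping.lookup a i" "Poly_Mapping.lookup b i" u e]
    std_cube_coord[OF assms(1), of i] std_cube_coord[OF assms(2), of i] assms(3,4)
  by (simp add: lookup_add)

lemma std_face_face_of: "std_face d \<phi> face_of std_cube d"
proof -
  \<comment> \<open>One direction of this equivalence is convexity, the other the extremality of a
    face.\<close>
  have comb: "(1 - u) *\<^sub>R a + u *\<^sub>R b \<in> std_face d \<phi> \<longleftrightarrow> a \<in> std_face d \<phi> \<and> b \<in> std_face d \<phi>"
    if ab: "a \<in> std_cube d" "b \<in> std_cube d" and u: "0 < u" "u < 1" for a b u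
  proof -
    have "(1 - u) *\<^sub>R a + u *\<^sub>R b \<in> std_cube d"
      using convexD[OF convex_std_cube ab, of "1 - u" u] u by simp
    then show ?thesis
      using ab unfolding std_face_def by (simp add: toward_comb[OF ab u]) blast
  qed
  have "convex (std_face d \<phi>)"
    unfolding convex_contains_open_segment
  proof (intro ballI subsetI)
    fix a b x assume ab: "a \<in> std_face d \<phi>" "b \<in> std_face d \<phi>" and "x \<in> open_segment a b"
    then obtain u where "0 < u" "u < 1" "x = (1 - u) *\<^sub>R a + u *\<^sub>R b"
      by (auto simp: in_segment)
    then show "x \<in> std_face d \<phi>"
      using comb[of a b u] ab by (simp add: std_face_def)
  qed
  moreover have "a \<in> std_face d \<phi> \<and> b \<in> std_face d \<phi>"
    if "a \<in> std_cube d" "b \<in> std_cube d" "x \<in> std_face d \<phi>" "x \<in> open_segment a b" for a b x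
  proof -
    obtain u where "0 < u" "u < 1" "x = (1 - u) *\<^sub>R a + u *\<^sub>R b"
      using \<open>x \<in> open_segment a b\<close> by (auto simp: in_segment)
    then show ?thesis
      using comb[of a b u] that by simp
  qed
  moreover have "std_face d \<phi> \<subseteq> std_cube d"
    by (auto simp: std_face_def)
  ultimately show ?thesis
    unfolding face_of_def by blast
qed

text \<open>Vertices serve as test points for nonemptiness and inclusion of faces.\<close>

lemma std_face_vertex:
  assumes "\<And>j. j < d \<Longrightarrow> g j \<in> \<phi> j"
  obtains v where "v \<in> std_face d \<phi>"
    "\<And>j. j < d \<Longrightarrow> toward (g j) (Poly_Mapping.lookup v j)"
proof -
  define v :: point where "v = Abs_poly_mapping (\<lambda>j. of_bool (j < d \<and> g j))"
  have "finite {j. of_bool (j < d \<and> g j) \<noteq> (0 :: real)}"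
    by (rule finite_subset[of _ "{..<d}"]) auto
  then have v: "Poly_Mapping.lookup v j = of_bool (j < d \<and> g j)" for j
    by (simp add: v_def)
  have toward: "toward e (Poly_Mapping.lookup v j) \<longleftrightarrow> e = g j" if "j < d" for j e
    using that by (simp add: v toward_def)
  have "v \<in> std_face d \<phi>"
    using assms toward by (simp add: std_face_def std_cube_def v)
  then show ?thesis
    using that toward by metis
qed

lemma std_face_nonempty:
  assumes "\<phi> \<in> cube_faces d"
  shows "std_face d \<phi> \<noteq> {}"
proof -
  have "\<forall>j. \<exists>e. j < d \<longrightarrow> e \<in> \<phi> j"
    using cube_faces_nonempty[OF assms] by blast
  then obtain g where "\<forall>j. j < d \<longrightarrow> g j \<in> \<phi> j"
    using choice[of "\<lambda>j e. j < d \<longrightarrow> e \<in> \<phi> j"] by blast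
  then obtain v where "v \<in> std_face d \<phi>"
    using std_face_vertex[of d g \<phi>] by metis
  then show ?thesis
    by blast
qed

lemma std_face_subset_iff:
  assumes \<phi>: "\<phi> \<in> cube_faces d" and \<psi>: "\<psi> \<in> cube_faces d"
  shows "std_face d \<phi> \<subseteq> std_face d \<psi> \<longleftrightarrow> (\<forall>i<d. \<phi> i \<subseteq> \<psi> i)"
proof
  show "std_face d \<phi> \<subseteq> std_face d \<psi>" if "\<forall>i<d. \<phi> i \<subseteq> \<psi> i"
    using that by (auto simp: std_face_def)
next
  assume sub: "std_face d \<phi> \<subseteq> std_face d \<psi>"
  have "\<forall>j. \<exists>e. j < d \<longrightarrow> e \<in> \<phi> j"
    using cube_faces_nonempty[OF \<phi>] by blast
  then obtain g where g: "\<forall>j. j < d \<longrightarrow> g j \<in> \<phi> j"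
    using choice[of "\<lambda>j e. j < d \<longrightarrow> e \<in> \<phi> j"] by blast
  show "\<forall>i<d. \<phi> i \<subseteq> \<psi> i"
  proof (intro allI impI subsetI)
    fix i e assume i: "i < d" and e: "e \<in> \<phi> i"
    \<comment> \<open>A vertex of the smaller face whose coordinate \<open>i\<close> is the end
      point \<open>e\<close> witnesses that \<open>e\<close> is admissible on the larger
      one.\<close>
    have "(g(i := e)) j \<in> \<phi> j" if "j < d" for j
      using g e that by simp
    then obtain v where v: "v \<in> std_face d \<phi>"
      "\<And>j. j < d \<Longrightarrow> toward ((g(i := e)) j) (Poly_Mapping.lookup v j)"
      by (rule std_face_vertex[of d "g(i := e)" \<phi>]) simp_all
    then have "v \<in> std_face d \<psi>"
      using sub by blast
    then show "e \<in> \<psi> i"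
      using v(2)[OF i] i by (simp add: std_face_def)
  qed
qed

text \<open>Collecting the end points toward which points of \<open>F\<close> lie gives
  \<open>\<phi>\<close>. Averaging yields one point \<open>y\<close> of \<open>F\<close> with all
  these properties at once, thus in the relative interior of \<open>std_face d \<phi>\<close>. A
  segment from any \<open>x\<close> of that face can be prolonged beyond \<open>y\<close> inside the
  cube, so \<open>x\<close> lies in \<open>F\<close>.\<close>

lemma face_of_std_cube:
  assumes F: "F face_of std_cube d" "F \<noteq> {}"
  obtains \<phi> where "\<phi> \<in> cube_faces d" "F = std_face d \<phi>"
proof -
  let ?l = "Poly_Mapping.lookup :: point \<Rightarrow> nat \<Rightarrow> real"
  define \<phi> where "\<phi> = (\<lambda>i\<in>{..<d}. {e. \<exists>x\<in>F. toward e (?l x i)})"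
  have cube: "x \<in> std_cube d" if "x \<in> F" for x
    using F(1) that by (auto simp: face_of_def)
  have toward_ex: "toward True t \<or> toward False t" for t
    by (simp add: toward_def) linarith
  have \<phi>I: "e \<in> \<phi> i" if "i < d" "x \<in> F" "toward e (?l x i)" for i e x
    using that unfolding \<phi>_def by simp blast
  have \<phi>D: "\<exists>x\<in>F. toward e (?l x i)" if "i < d" "e \<in> \<phi> i" for i e
    using that unfolding \<phi>_def by simp
  have "\<phi> i \<noteq> {}" if "i < d" for i
    using F(2) toward_ex \<phi>I[OF that] by blast
  then have "\<phi> \<in> cube_faces d"
    unfolding cube_faces_def by (intro PiE_I) (simp_all add: \<phi>_def)
  moreover have "F = std_face d \<phi>"
  proof
    show "F \<subseteq> std_face d \<phi>"
      using cube \<phi>I unfolding std_face_def by blast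
    have ex: "\<exists>y\<in>F. \<forall>(i, e)\<in>A. toward e (?l y i)"
      if "finite A" "A \<subseteq> {(i, e). i < d \<and> e \<in> \<phi> i}" for A
      using that
    proof (induction A rule: finite_induct)
      case empty
      then show ?case using F(2) by blast
    next
      case (insert p A)
      obtain i e where p: "p = (i, e)" by (cases p)
      obtain y where y: "y \<in> F" "\<forall>(i, e)\<in>A. toward e (?l y i)"
        using insert by blast
      obtain w where w: "w \<in> F" "toward e (?l w i)"
        using insert.prems \<phi>D[of i e] unfolding p by blast
      \<comment> \<open>The midpoint inherits the \<open>toward\<close> properties of both end
        points of the segment.\<close>
      let ?m = "(1 - 1 / 2) *\<^sub>R y + (1 / 2 :: real) *\<^sub>R w"
      have "?m \<in> F"
        using face_of_imp_convex[OF F(1)] y(1) w(1) by (rule convexD) auto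
      moreover have "toward e' (?l ?m j) \<longleftrightarrow> toward e' (?l y j) \<or> toward e' (?l w j)" for e' j
        by (rule toward_comb) (use y(1) w(1) cube in auto)
      ultimately show ?case
        using y(2) w(2) unfolding p by (intro bexI[of _ ?m]) auto
    qed
    have "finite {(i, e). i < d \<and> e \<in> \<phi> i}"
      by (rule finite_subset[of _ "{..<d} \<times> UNIV"]) auto
    from ex[OF this subset_refl] obtain y where y1: "y \<in> F"
      and y2: "\<forall>(i, e)\<in>{(i, e). i < d \<and> e \<in> \<phi> i}. toward e (?l y i)"
      by (rule bexE)
    have y: "toward e (?l y i)" if "i < d" "e \<in> \<phi> i" for i e
      using bspec[OF y2, of "(i, e)"] that by simp
    show "std_face d \<phi> \<subseteq> F"
    proof
      fix x assume x: "x \<in> std_face d \<phi>"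
      then have xc: "x \<in> std_cube d"
        by (simp add: std_face_def)
      have yc: "y \<in> std_cube d"
        using cube y1 by blast
      \<comment> \<open>\<open>\<epsilon>\<close> is at most every nonzero distance of a coordinate
        of \<open>y\<close> from \<open>0\<close> or \<open>1\<close>; the inserted \<open>1\<close>
        keeps the set nonempty.\<close>
      define S where "S = insert 1 ((?l y ` {..<d} \<union> (\<lambda>i. 1 - ?l y i) ` {..<d}) \<inter> {0<..})"
      define \<epsilon> where "\<epsilon> = Min S"
      have S: "finite S" "S \<noteq> {}" "S \<subseteq> {0<..}"
        by (auto simp: S_def)
      have \<epsilon>: "0 < \<epsilon>"
        using S Min_in[OF S(1,2)] by (auto simp: \<epsilon>_def)
      have le: "0 < ?l y i \<Longrightarrow> \<epsilon> \<le> ?l y i" "?l y i < 1 \<Longrightarrow> \<epsilon> \<le> 1 - ?l y i" if "i < d" for i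
        unfolding \<epsilon>_def using that by (auto intro!: Min_le[OF S(1)] simp: S_def)
      define w where "w = y + \<epsilon> *\<^sub>R (y - x)"
      have lw: "?l w i = ?l y i + \<epsilon> * (?l y i - ?l x i)" for i
        by (simp add: w_def lookup_add lookup_minus)
      have "0 \<le> ?l w i \<and> ?l w i \<le> 1" if i: "i < d" for i
      proof
        have x01: "0 \<le> ?l x i" "?l x i \<le> 1" and y01: "0 \<le> ?l y i" "?l y i \<le> 1"
          using std_cube_coord[OF xc, of i] std_cube_coord[OF yc, of i] by auto
        show "0 \<le> ?l w i"
        proof (cases "0 < ?l y i")
          case True
          have "\<epsilon> * ?l x i \<le> \<epsilon> * 1" "0 \<le> \<epsilon> * ?l y i"
            using \<epsilon> x01 y01 by (auto intro: mult_left_mono)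
          then show ?thesis
            using le(1)[OF i True] by (simp add: lw algebra_simps)
        next
          case False
          \<comment> \<open>Here \<open>y\<close> has coordinate \<open>0\<close>, which forces
            \<open>x\<close> to have coordinate \<open>0\<close> as well, so the prolongation does
            not move it.\<close>
          then have "True \<notin> \<phi> i"
            using y[OF i, of True] by (auto simp: toward_def)
          then have "\<not> toward True (?l x i)"
            using x i by (auto simp: std_face_def)
          then show ?thesis
            using False x01 y01 by (simp add: lw toward_def)
        qed
        show "?l w i \<le> 1"
        proof (cases "?l y i < 1")
          case True
          have "\<epsilon> * (?l y i - ?l x i) \<le> \<epsilon> * 1"
            using \<epsilon> x01 y01 by (intro mult_left_mono) auto
          then show ?thesis
            using le(2)[OF i True] by (simp add: lw)
        next
          case False
          then have "False \<notin> \<phi> i"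
            using y[OF i, of False] by (auto simp: toward_def)
          then have "\<not> toward False (?l x i)"
            using x i by (auto simp: std_face_def)
          then show ?thesis
            using False x01 y01 by (simp add: lw toward_def)
        qed
      qed
      moreover have "?l w i = 0" if "d \<le> i" for i
        using xc yc that by (simp add: lw std_cube_def)
      ultimately have wc: "w \<in> std_cube d"
        by (simp add: std_cube_def)
      show "x \<in> F"
      proof (cases "x = y")
        case False
        define u where "u = 1 / (1 + \<epsilon>)"
        have u: "0 < u" "u < 1" "u * (1 + \<epsilon>) = 1"
          using \<epsilon> by (simp_all add: u_def)
        have "(1 - u) *\<^sub>R x + u *\<^sub>R w = (u * (1 + \<epsilon>)) *\<^sub>R y + (1 - u * (1 + \<epsilon>)) *\<^sub>R x"
          by (simp add: w_def algebra_simps)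
        then have "y = (1 - u) *\<^sub>R x + u *\<^sub>R w"
          using u(3) by simp
        moreover have "x \<noteq> w"
        proof
          assume "x = w"
          then have "(1 + \<epsilon>) *\<^sub>R (y - x) = 0"
            by (simp add: w_def algebra_simps)
          then show False
            using False \<epsilon> by simp
        qed
        ultimately have "y \<in> open_segment x w"
          using u(1,2) by (auto simp: in_segment)
        then show ?thesis
          using face_ofD[OF F(1) _ xc wc y1] by blast
      qed (use y1 in simp)
    qed
  qed
  ultimately show ?thesis
    using that by blast
qed

lemma cube_param_std_cube: "cube_param d (face_lattice (std_cube d)) (std_face d)"
proof -
  have "inj_on (std_face d) (cube_faces d)"
  proof (rule inj_onI)
    fix \<phi> \<psi> assume *: "\<phi> \<in> cube_faces d" "\<psi> \<in> cube_faces d" "std_face d \<phi> = std_face d \<psi>"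
    then have "\<phi> i = \<psi> i" if "i < d" for i
      using std_face_subset_iff[OF *(1,2)] std_face_subset_iff[OF *(2,1)] that by auto
    then show "\<phi> = \<psi>"
      using cube_faces_eqI[OF *(1,2)] by blast
  qed
  moreover have "std_face d ` cube_faces d = face_lattice (std_cube d) - {{}}"
  proof (intro set_eqI iffI)
    fix F assume "F \<in> face_lattice (std_cube d) - {{}}"
    then show "F \<in> std_face d ` cube_faces d"
      using face_of_std_cube[of F d] by (auto simp: face_lattice_def)
  qed (use std_face_face_of std_face_nonempty in \<open>auto simp: face_lattice_def\<close>)
  ultimately show ?thesis
    using std_face_subset_iff by (simp add: cube_param_def bij_betw_def face_lattice_def)
qed

section \<open>Stable relative complexes on cubes\<close>

definition cube_facet :: "nat \<Rightarrow> nat \<Rightarrow> bool \<Rightarrow> nat \<Rightarrow> bool set" where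
  "cube_facet d i e = (\<lambda>j\<in>{..<d}. if j = i then {e} else UNIV)"

lemma cube_facet_in_cube_faces: "cube_facet d i e \<in> cube_faces d"
  unfolding cube_facet_def cube_faces_def by (rule restrict_PiE_iff[THEN iffD2]) simp

lemma cube_param_below_facet:
  assumes \<beta>: "cube_param d L \<beta>" and "\<psi> \<in> cube_faces d" "i < d"
  shows "\<beta> \<psi> \<subseteq> \<beta> (cube_facet d i e) \<longleftrightarrow> \<psi> i = {e}"
proof -
  have "(\<forall>j<d. \<psi> j \<subseteq> cube_facet d i e j) \<longleftrightarrow> \<psi> i \<subseteq> {e}"
    using assms(3) by (auto simp: cube_facet_def)
  also have "\<dots> \<longleftrightarrow> \<psi> i = {e}"
    using cube_faces_nonempty[OF assms(2,3)] by (simp add: subset_singleton_iff)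
  finally show ?thesis
    using cube_param_subset_iff[OF \<beta> assms(2) cube_facet_in_cube_faces] by simp
qed

lemma cube_param_below_some_facet:
  assumes \<beta>: "cube_param d L \<beta>" and \<psi>: "\<psi> \<in> cube_faces d" "\<psi> \<noteq> full_face d"
  obtains i e where "i < d" "\<psi> i = {e}"
proof -
  obtain i where "i < d" "\<psi> i \<noteq> UNIV"
    using cube_faces_eqI[OF \<psi>(1) full_face_in_cube_faces] \<psi>(2) full_face_apply by metis
  then show ?thesis
    using that bool_set_singleton cube_faces_nonempty[OF \<psi>(1)] by metis
qed

lemma mem_face_lattice_face:
  assumes "X face_of P" "G face_of P"
  shows "X \<in> face_lattice G \<longleftrightarrow> X \<subseteq> G"
  using face_of_imp_subset[of X G] face_of_subset[OF assms(1), of G] face_of_imp_subset[OF assms(2)]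
  unfolding face_lattice_def mem_Collect_eq by metis

text \<open>The conditions act on each coordinate separately, so the enumerator is a product. The
  reference face \<open>\<phi>\<close> sorts the coordinates into those contributing
  \<open>p\<close> and those contributing \<open>q\<close>.\<close>

lemma sum_cube_chain_sum:
  assumes "\<And>i. i < d \<Longrightarrow>
    (\<Sum>s | s \<noteq> {} \<and> Q i s. end_point_weight s) = (if \<phi> i = UNIV then p else q)"
  shows "(\<Sum>\<psi> | \<psi> \<in> cube_faces d \<and> (\<forall>i<d. Q i (\<psi> i)). cube_chain_sum y (free_dim d \<psi>)) =
    chain_functional y (p ^ free_dim d \<phi> * q ^ (d - free_dim d \<phi>))"
proof -
  let ?I = "{i \<in> {..<d}. \<phi> i = UNIV}"
  have "{\<psi> \<in> cube_faces d. \<forall>i<d. Q i (\<psi> i)} = PiE {..<d} (\<lambda>i. {s. s \<noteq> {} \<and> Q i s})"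
    unfolding cube_faces_def by (intro set_eqI) (simp add: PiE_iff, blast)
  then have "(\<Sum>\<psi> | \<psi> \<in> cube_faces d \<and> (\<forall>i<d. Q i (\<psi> i)). cube_chain_sum y (free_dim d \<psi>)) =
      chain_functional y (\<Sum>\<psi>\<in>PiE {..<d} (\<lambda>i. {s. s \<noteq> {} \<and> Q i s}). monom 1 (free_dim d \<psi>))"
    by (simp add: chain_functional_sum)
  also have "(\<Sum>\<psi>\<in>PiE {..<d} (\<lambda>i. {s. s \<noteq> {} \<and> Q i s}). monom 1 (free_dim d \<psi>)) =
      (\<Prod>i<d. if \<phi> i = UNIV then p else q)"
    unfolding sum_monom_free_dim by (intro prod.cong) (simp_all add: assms)
  also have "\<dots> = p ^ card ?I * q ^ card ({..<d} - ?I)"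
  proof -
    have "{..<d} \<inter> {i. \<phi> i = UNIV} = ?I" "{..<d} \<inter> - {i. \<phi> i = UNIV} = {..<d} - ?I"
      by auto
    then show ?thesis
      by (simp only: prod.If_cases finite_lessThan prod_constant)
  qed
  also have "card ({..<d} - ?I) = d - card ?I"
    by (subst card_Diff_subset) auto
  finally show ?thesis
    by (simp add: free_dim_def)
qed

lemma free_dim_le: "free_dim d \<phi> \<le> d"
  unfolding free_dim_def using card_mono[of "{..<d}" "{i \<in> {..<d}. \<phi> i = UNIV}"] by auto

lemma free_dim_eq_iff: "free_dim d \<phi> = d \<longleftrightarrow> (\<forall>i<d. \<phi> i = UNIV)"
proof
  assume "free_dim d \<phi> = d"
  then have "{i \<in> {..<d}. \<phi> i = UNIV} = {..<d}"
    unfolding free_dim_def by (intro card_subset_eq) auto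
  then show "\<forall>i<d. \<phi> i = UNIV"
    by blast
next
  assume "\<forall>i<d. \<phi> i = UNIV"
  then have "{i \<in> {..<d}. \<phi> i = UNIV} = {..<d}"
    by auto
  then show "free_dim d \<phi> = d"
    by (simp add: free_dim_def)
qed

lemma stable_values_stable_value: "s \<le> d \<Longrightarrow> \<exists>j<2 * d + 2. stable_value y d s = stable_values y d j"
  by (intro exI[of _ s]) (simp add: stable_values_def)

lemma stable_values_stable_value': "s \<le> d \<Longrightarrow> \<exists>j<2 * d + 2. stable_value' y d s = stable_values y d j"
  by (intro exI[of _ "Suc d + s"]) (simp add: stable_values_def)

lemma empty_in_union_face_lattices: "{} \<in> (\<Union>G\<in>A. face_lattice G) \<longleftrightarrow> A \<noteq> {}"
  by (auto simp: face_lattice_def)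

lemma coatoms_above_subset: "coatoms_above P F \<subseteq> face_lattice P"
  by (auto simp: coatoms_above_def facets_def)

section \<open>Reciprocal domains of a polytope with the face lattice of a cube\<close>

context
  fixes d :: nat and P :: "point set" and \<gamma> :: "(nat \<Rightarrow> bool set) \<Rightarrow> point set"
  assumes \<gamma>: "cube_param d (face_lattice P) \<gamma>" and P: "convex P"
begin

lemma \<gamma>_full_face: "\<gamma> (full_face d) = P"
  by (rule cube_param_full_face[OF \<gamma>])
    (simp_all add: face_lattice_def face_of_refl[OF P] face_of_imp_subset)

lemma facet_neq_P:
  assumes "i < d"
  shows "\<gamma> (cube_facet d i e) \<noteq> P"
proof
  assume "\<gamma> (cube_facet d i e) = P"
  then have "\<gamma> (full_face d) \<subseteq> \<gamma> (cube_facet d i e)"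
    by (simp add: \<gamma>_full_face)
  then show False
    using cube_param_below_facet[OF \<gamma> full_face_in_cube_faces assms] singleton_bool_neq_UNIV assms
    by (metis full_face_apply)
qed

text \<open>Facets of a cube fix exactly one coordinate. Nonemptiness sets aside the case
  \<open>d = 0\<close>, where the empty face is the coatom.\<close>

lemma nonempty_coatom_iff:
  assumes G: "G \<noteq> {}"
  shows "G \<in> coatoms_above P F \<longleftrightarrow> F \<subseteq> G \<and> (\<exists>i<d. \<exists>e. G = \<gamma> (cube_facet d i e))"
proof
  assume co: "G \<in> coatoms_above P F"
  then have GL: "G \<in> face_lattice P" and FG: "F \<subseteq> G" and "G \<noteq> P"
    and max: "\<And>H. H \<in> face_lattice P \<Longrightarrow> F \<subseteq> H \<Longrightarrow> H \<noteq> P \<Longrightarrow> G \<subseteq> H \<Longrightarrow> H = G"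
    unfolding coatoms_above_def facets_def by simp_all
  obtain \<psi> where \<psi>: "\<psi> \<in> cube_faces d" "G = \<gamma> \<psi>"
    using cube_param_face_cases[OF \<gamma> GL G] by metis
  then obtain i e where ie: "i < d" "\<psi> i = {e}"
    using cube_param_below_some_facet[OF \<gamma> \<psi>(1)] \<gamma>_full_face \<open>G \<noteq> P\<close> by metis
  let ?H = "\<gamma> (cube_facet d i e)"
  have "G \<subseteq> ?H"
    using cube_param_below_facet[OF \<gamma> \<psi>(1) ie(1)] ie(2) \<psi>(2) by metis
  moreover have "?H \<in> face_lattice P"
    using cube_param_face_nonempty[OF \<gamma> cube_facet_in_cube_faces] by metis
  ultimately have "?H = G"
    using max[of ?H] FG facet_neq_P[OF ie(1)] by (metis order_trans)
  then show "F \<subseteq> G \<and> (\<exists>i<d. \<exists>e. G = \<gamma> (cube_facet d i e))"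
    using FG ie(1) by metis
next
  assume "F \<subseteq> G \<and> (\<exists>i<d. \<exists>e. G = \<gamma> (cube_facet d i e))"
  then obtain i e where FG: "F \<subseteq> G" and i: "i < d" and G_eq: "G = \<gamma> (cube_facet d i e)"
    by metis
  note facet = cube_facet_in_cube_faces[of d i e]
  have "H = G" if H: "H \<in> face_lattice P" "H \<noteq> P" "G \<subseteq> H" for H
  proof -
    have "H \<noteq> {}" using G H(3) by blast
    then obtain \<psi> where \<psi>: "\<psi> \<in> cube_faces d" "H = \<gamma> \<psi>"
      using cube_param_face_cases[OF \<gamma> H(1)] by metis
    then obtain j e' where je: "j < d" "\<psi> j = {e'}"
      using cube_param_below_some_facet[OF \<gamma> \<psi>(1)] \<gamma>_full_face H(2) by metis
    have le: "cube_facet d i e k \<subseteq> \<psi> k" if "k < d" for k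
      using cube_param_subset_iff[OF \<gamma> facet \<psi>(1)] H(3) \<psi>(2) G_eq that by metis
    have "j = i"
    proof (rule ccontr)
      assume "j \<noteq> i"
      then have "UNIV \<subseteq> {e'}"
        using le[OF je(1)] je by (simp add: cube_facet_def)
      then show False
        using singleton_bool_neq_UNIV[of e'] by blast
    qed
    then have "\<psi> i = {e}"
      using le[OF je(1)] je i by (simp add: cube_facet_def)
    then have "H \<subseteq> G"
      using cube_param_below_facet[OF \<gamma> \<psi>(1) i] \<psi>(2) G_eq by metis
    then show ?thesis
      using H(3) by simp
  qed
  moreover have "G \<in> face_lattice P" "G \<noteq> P"
    using cube_param_face_nonempty[OF \<gamma> facet] facet_neq_P[OF i] G_eq by metis+
  ultimately show "G \<in> coatoms_above P F"
    using FG unfolding coatoms_above_def facets_def by simp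
qed

lemma facet_nonempty: "\<gamma> (cube_facet d i e) \<noteq> {}"
  using cube_param_face_nonempty[OF \<gamma> cube_facet_in_cube_faces] by metis

lemma facet_coatom_iff: "i < d \<Longrightarrow> \<gamma> (cube_facet d i e) \<in> coatoms_above P F \<longleftrightarrow> F \<subseteq> \<gamma> (cube_facet d i e)"
  using nonempty_coatom_iff[OF facet_nonempty] by metis

lemma empty_coatom:
  assumes "d = 0"
  shows "{} \<in> coatoms_above P {}"
proof -
  have "\<phi> = full_face d" if "\<phi> \<in> cube_faces d" for \<phi>
    using cube_faces_eqI[OF that full_face_in_cube_faces] assms by simp
  then have "G = {} \<or> G = P" if "G \<in> face_lattice P" for G
    using cube_param_face_cases[OF \<gamma> that] \<gamma>_full_face by metis
  moreover have "{} \<in> face_lattice P" "P \<noteq> {}"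
    using \<gamma> cube_param_face_nonempty[OF \<gamma> full_face_in_cube_faces] \<gamma>_full_face
    by (auto simp: cube_param_def)
  ultimately show ?thesis
    unfolding coatoms_above_def facets_def by simp metis
qed

lemma face_in_union_iff:
  assumes "\<psi> \<in> cube_faces d" "A \<subseteq> face_lattice P" and A: "\<And>G. G \<in> A \<Longrightarrow> G \<in> coatoms_above P {}"
  shows "\<gamma> \<psi> \<in> (\<Union>G\<in>A. face_lattice G) \<longleftrightarrow> (\<exists>i<d. \<exists>e. \<gamma> (cube_facet d i e) \<in> A \<and> \<psi> i = {e})"
proof -
  have X: "\<gamma> \<psi> face_of P" "\<gamma> \<psi> \<noteq> {}"
    using cube_param_face_nonempty[OF \<gamma> assms(1)] by (simp_all add: face_lattice_def)
  have "\<gamma> \<psi> \<in> (\<Union>G\<in>A. face_lattice G) \<longleftrightarrow> (\<exists>G\<in>A. \<gamma> \<psi> \<subseteq> G)"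
    using mem_face_lattice_face[OF X(1)] assms(2) by (auto simp: face_lattice_def)
  also have "\<dots> \<longleftrightarrow> (\<exists>i<d. \<exists>e. \<gamma> (cube_facet d i e) \<in> A \<and> \<gamma> \<psi> \<subseteq> \<gamma> (cube_facet d i e))"
    using nonempty_coatom_iff[of _ "{}"] A X(2) by (metis subset_empty)
  also have "\<dots> \<longleftrightarrow> (\<exists>i<d. \<exists>e. \<gamma> (cube_facet d i e) \<in> A \<and> \<psi> i = {e})"
    using cube_param_below_facet[OF \<gamma> assms(1)] by metis
  finally show ?thesis .
qed

lemma coatoms_above_empty_mono:
  assumes "G \<in> coatoms_above P F"
  shows "G \<in> coatoms_above P {}"
proof (cases "G = {}")
  case True
  then have "F = {}"
    using assms by (simp add: coatoms_above_def facets_def)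
  then show ?thesis
    using assms by simp
next
  case False
  then show ?thesis
    using assms unfolding nonempty_coatom_iff[OF False] by simp
qed

lemma face_in_closed_domain_iff:
  assumes "\<psi> \<in> cube_faces d"
  shows "\<gamma> \<psi> \<in> (\<Union>G\<in>coatoms_above P F. face_lattice G) \<longleftrightarrow>
    (\<exists>i<d. \<exists>e. F \<subseteq> \<gamma> (cube_facet d i e) \<and> \<psi> i = {e})"
proof -
  have "\<gamma> \<psi> \<in> (\<Union>G\<in>coatoms_above P F. face_lattice G) \<longleftrightarrow>
      (\<exists>i<d. \<exists>e. \<gamma> (cube_facet d i e) \<in> coatoms_above P F \<and> \<psi> i = {e})"
    using assms coatoms_above_subset coatoms_above_empty_mono by (rule face_in_union_iff)
  then show ?thesis
    using facet_coatom_iff by metis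
qed

lemma face_in_open_domain_iff:
  assumes "\<psi> \<in> cube_faces d"
  shows "\<gamma> \<psi> \<in> (\<Union>G\<in>coatoms_above P {} - coatoms_above P F. face_lattice G) \<longleftrightarrow>
    (\<exists>i<d. \<exists>e. \<not> F \<subseteq> \<gamma> (cube_facet d i e) \<and> \<psi> i = {e})"
proof -
  let ?A = "coatoms_above P {} - coatoms_above P F"
  have "?A \<subseteq> face_lattice P" "\<And>G. G \<in> ?A \<Longrightarrow> G \<in> coatoms_above P {}"
    using coatoms_above_subset by blast+
  then have "\<gamma> \<psi> \<in> (\<Union>G\<in>?A. face_lattice G) \<longleftrightarrow>
      (\<exists>i<d. \<exists>e. \<gamma> (cube_facet d i e) \<in> ?A \<and> \<psi> i = {e})"
    by (rule face_in_union_iff[OF assms])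
  moreover have "\<gamma> (cube_facet d i e) \<in> ?A \<longleftrightarrow> \<not> F \<subseteq> \<gamma> (cube_facet d i e)" if "i < d" for i e
    using facet_coatom_iff[OF that] by simp
  ultimately show ?thesis
    by metis
qed

text \<open>A nonempty face cannot lie in two opposite facets. For \<open>d = 0\<close> the coatom
  missing \<open>F\<close> is the empty face.\<close>

lemma empty_in_open_domain:
  assumes "F \<in> face_lattice P" "F \<noteq> {}"
  shows "coatoms_above P {} - coatoms_above P F \<noteq> {}"
proof (cases "d = 0")
  case True
  have "{} \<notin> coatoms_above P F"
    using assms(2) by (simp add: coatoms_above_def facets_def)
  then show ?thesis
    using empty_coatom[OF True] by blast
next
  case False
  obtain \<phi> where \<phi>: "\<phi> \<in> cube_faces d" "F = \<gamma> \<phi>"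
    using cube_param_face_cases[OF \<gamma> assms] by metis
  have "{True} \<noteq> {False}"
    by simp
  then obtain e where "\<phi> 0 \<noteq> {e}"
    by metis
  then have "\<not> F \<subseteq> \<gamma> (cube_facet d 0 e)"
    using cube_param_below_facet[OF \<gamma> \<phi>(1), of 0 e] False \<phi>(2) by simp
  then have "\<gamma> (cube_facet d 0 e) \<in> coatoms_above P {} - coatoms_above P F"
    using facet_coatom_iff[of 0 e] False by simp
  then show ?thesis
    by blast
qed

text \<open>For \<open>F = {}\<close> all facets go and only the cube is left, with enumerator
  \<open>t ^ d\<close>. Otherwise the facets through \<open>F\<close> are given by the
  \<open>d - free_dim d \<phi>\<close> fixed coordinates of \<open>F\<close>, and each of these
  loses one end point.\<close>

lemma closed_domain_sum:
  assumes F: "F \<in> face_lattice P" and D: "D = (\<Union>G\<in>coatoms_above P F. face_lattice G)"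
  shows "\<exists>j<2 * d + 2.
    (\<Sum>\<psi> | \<psi> \<in> cube_faces d \<and> \<gamma> \<psi> \<notin> D. cube_chain_sum y (free_dim d \<psi>)) +
      (if {} \<in> D then 0 else 1) = stable_values y d j"
proof (cases "F = {}")
  case True
  have mem: "\<gamma> \<psi> \<notin> D \<longleftrightarrow> (\<forall>i<d. \<forall>e. \<psi> i \<noteq> {e})" if "\<psi> \<in> cube_faces d" for \<psi>
    unfolding D True face_in_closed_domain_iff[OF that] by simp
  have set: "{\<psi> \<in> cube_faces d. \<gamma> \<psi> \<notin> D} = {\<psi> \<in> cube_faces d. \<forall>i<d. \<forall>e. \<psi> i \<noteq> {e}}"
    by (intro Collect_cong conj_cong refl mem)
  have "s \<noteq> {} \<and> (\<forall>e. s \<noteq> {e}) \<longleftrightarrow> s = UNIV" for s :: "bool set"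
    using bool_set_singleton[of s] singleton_bool_neq_UNIV by (metis UNIV_not_empty)
  \<comment> \<open>The second value is a dummy: every coordinate of \<open>full_face d\<close> is
    free, so its exponent is \<open>0\<close>.\<close>
  then have "(\<Sum>s | s \<noteq> {} \<and> (\<forall>e. s \<noteq> {e}). end_point_weight s) =
      (if full_face d i = UNIV then [:0, 1:] else [:1, 1:])" if "i < d" for i
    using that by (simp add: full_face_apply end_point_weight_def)
  then have "(\<Sum>\<psi> | \<psi> \<in> cube_faces d \<and> \<gamma> \<psi> \<notin> D. cube_chain_sum y (free_dim d \<psi>)) =
      chain_functional y ([:0, 1:] ^ free_dim d (full_face d) *
        [:1, 1:] ^ (d - free_dim d (full_face d)))"
    unfolding set by (rule sum_cube_chain_sum)
  moreover have "free_dim d (full_face d) = d"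
    using free_dim_eq_iff full_face_apply by blast
  moreover have "coatoms_above P F \<noteq> {}"
  proof (cases "d = 0")
    case True
    then show ?thesis
      using empty_coatom \<open>F = {}\<close> by blast
  next
    case False
    then show ?thesis
      using facet_coatom_iff[of 0 True F] \<open>F = {}\<close> by blast
  qed
  ultimately show ?thesis
    using stable_values_stable_value'[of d d y]
    unfolding D empty_in_union_face_lattices by (simp add: stable_value'_def)
next
  case False
  then obtain \<phi> where \<phi>: "\<phi> \<in> cube_faces d" "F = \<gamma> \<phi>"
    using cube_param_face_cases[OF \<gamma> F] by metis
  have F_facet: "F \<subseteq> \<gamma> (cube_facet d i e) \<longleftrightarrow> \<phi> i = {e}" if "i < d" for i e
    using cube_param_below_facet[OF \<gamma> \<phi>(1) that] \<phi>(2) by simp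
  have sing: "\<exists>e. \<phi> i = {e}" if "i < d" "\<phi> i \<noteq> UNIV" for i
    using bool_set_singleton[OF cube_faces_nonempty[OF \<phi>(1) that(1)] that(2)] by metis
  have mem: "\<gamma> \<psi> \<notin> D \<longleftrightarrow> (\<forall>i<d. \<phi> i \<noteq> UNIV \<longrightarrow> \<psi> i \<noteq> \<phi> i)" if "\<psi> \<in> cube_faces d" for \<psi>
    unfolding D face_in_closed_domain_iff[OF that] using F_facet sing singleton_bool_neq_UNIV by metis
  have set: "{\<psi> \<in> cube_faces d. \<gamma> \<psi> \<notin> D} =
      {\<psi> \<in> cube_faces d. \<forall>i<d. \<phi> i \<noteq> UNIV \<longrightarrow> \<psi> i \<noteq> \<phi> i}"
    by (intro Collect_cong conj_cong refl mem)
  have "(\<Sum>s | s \<noteq> {} \<and> (\<phi> i \<noteq> UNIV \<longrightarrow> s \<noteq> \<phi> i). end_point_weight s) =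
      (if \<phi> i = UNIV then [:2, 1:] else [:1, 1:])" if i: "i < d" for i
  proof (cases "\<phi> i = UNIV")
    case True
    then show ?thesis by (simp add: sum_end_point_weight)
  next
    case False
    then obtain e where "\<phi> i = {e}" using sing[OF i] by metis
    then show ?thesis using False by (simp add: sum_end_point_weight_remove)
  qed
  then have "(\<Sum>\<psi> | \<psi> \<in> cube_faces d \<and> \<gamma> \<psi> \<notin> D. cube_chain_sum y (free_dim d \<psi>)) =
      chain_functional y ([:2, 1:] ^ free_dim d \<phi> * [:1, 1:] ^ (d - free_dim d \<phi>))"
    unfolding set by (rule sum_cube_chain_sum)
  \<comment> \<open>The empty face survives exactly when no facet is removed, that is, when
    \<open>F\<close> is the whole polytope; this matches the extra \<open>1\<close> in
    \<open>stable_value\<close>.\<close>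
  moreover have "{} \<in> D \<longleftrightarrow> d - free_dim d \<phi> \<noteq> 0"
  proof -
    have "{} \<notin> coatoms_above P F"
      using False by (simp add: coatoms_above_def facets_def)
    then have "coatoms_above P F \<noteq> {} \<longleftrightarrow> (\<exists>i<d. \<exists>e. \<phi> i = {e})"
      using nonempty_coatom_iff facet_coatom_iff F_facet by (metis ex_in_conv)
    also have "\<dots> \<longleftrightarrow> free_dim d \<phi> \<noteq> d"
      unfolding free_dim_eq_iff using sing singleton_bool_neq_UNIV by metis
    finally show ?thesis
      using free_dim_le[of d \<phi>] unfolding D empty_in_union_face_lattices by auto
  qed
  ultimately have "(\<Sum>\<psi> | \<psi> \<in> cube_faces d \<and> \<gamma> \<psi> \<notin> D. cube_chain_sum y (free_dim d \<psi>)) +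
      (if {} \<in> D then 0 else 1) = stable_value y d (d - free_dim d \<phi>)"
    using free_dim_le[of d \<phi>] by (auto simp: stable_value_def mult.commute)
  then show ?thesis
    using stable_values_stable_value[of "d - free_dim d \<phi>" d y] by simp
qed

text \<open>For \<open>F = {}\<close> nothing is removed. Otherwise a face survives iff each
  coordinate it fixes is fixed by \<open>F\<close> at the same end: free coordinates of
  \<open>F\<close> give \<open>t\<close>, fixed ones \<open>1 + t\<close>.\<close>

lemma open_domain_sum:
  assumes F: "F \<in> face_lattice P"
    and D: "D = (\<Union>G\<in>coatoms_above P {} - coatoms_above P F. face_lattice G)"
  shows "\<exists>j<2 * d + 2.
    (\<Sum>\<psi> | \<psi> \<in> cube_faces d \<and> \<gamma> \<psi> \<notin> D. cube_chain_sum y (free_dim d \<psi>)) +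
      (if {} \<in> D then 0 else 1) = stable_values y d j"
proof (cases "F = {}")
  case True
  \<comment> \<open>The vacuous condition brings the set into the coordinatewise form required for
    the product formula.\<close>
  have set: "{\<psi> \<in> cube_faces d. \<gamma> \<psi> \<notin> D} = {\<psi> \<in> cube_faces d. \<forall>i<d. True}"
    unfolding D True by simp
  have "(\<Sum>s | s \<noteq> {} \<and> True. end_point_weight s) =
      (if full_face d i = UNIV then [:2, 1:] else [:1, 1:])" if "i < d" for i
    using that by (simp add: full_face_apply sum_end_point_weight)
  then have "(\<Sum>\<psi> | \<psi> \<in> cube_faces d \<and> \<gamma> \<psi> \<notin> D. cube_chain_sum y (free_dim d \<psi>)) =
      chain_functional y ([:2, 1:] ^ free_dim d (full_face d) *
        [:1, 1:] ^ (d - free_dim d (full_face d)))"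
    unfolding set by (rule sum_cube_chain_sum)
  moreover have "free_dim d (full_face d) = d"
    using free_dim_eq_iff full_face_apply by blast
  moreover have "{} \<notin> D"
    unfolding D True by simp
  ultimately show ?thesis
    using stable_values_stable_value[of 0 d y] by (simp add: stable_value_def)
next
  case False
  then obtain \<phi> where \<phi>: "\<phi> \<in> cube_faces d" "F = \<gamma> \<phi>"
    using cube_param_face_cases[OF \<gamma> F] by metis
  have F_facet: "F \<subseteq> \<gamma> (cube_facet d i e) \<longleftrightarrow> \<phi> i = {e}" if "i < d" for i e
    using cube_param_below_facet[OF \<gamma> \<phi>(1) that] \<phi>(2) by simp
  have mem: "\<gamma> \<psi> \<notin> D \<longleftrightarrow> (\<forall>i<d. \<forall>e. \<psi> i = {e} \<longrightarrow> \<phi> i = {e})" if "\<psi> \<in> cube_faces d" for \<psi>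
    unfolding D face_in_open_domain_iff[OF that] using F_facet by metis
  have set: "{\<psi> \<in> cube_faces d. \<gamma> \<psi> \<notin> D} =
      {\<psi> \<in> cube_faces d. \<forall>i<d. \<forall>e. \<psi> i = {e} \<longrightarrow> \<phi> i = {e}}"
    by (intro Collect_cong conj_cong refl mem)
  have "(\<Sum>s | s \<noteq> {} \<and> (\<forall>e. s = {e} \<longrightarrow> \<phi> i = {e}). end_point_weight s) =
      (if \<phi> i = UNIV then [:0, 1:] else [:1, 1:])" if "i < d" for i
  proof -
    have iff: "s \<noteq> {} \<and> (\<forall>e. s = {e} \<longrightarrow> \<phi> i = {e}) \<longleftrightarrow> s = UNIV \<or> s = \<phi> i" for s
      using bool_set_singleton[of s] singleton_bool_neq_UNIV cube_faces_nonempty[OF \<phi>(1) that]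
      by (metis UNIV_not_empty)
    have "{s. s \<noteq> {} \<and> (\<forall>e. s = {e} \<longrightarrow> \<phi> i = {e})} = {UNIV, \<phi> i}"
      by (intro set_eqI) (simp only: iff mem_Collect_eq insert_iff empty_iff simp_thms)
    then show ?thesis
      by (cases "\<phi> i = UNIV") (simp_all add: end_point_weight_def one_pCons)
  qed
  then have "(\<Sum>\<psi> | \<psi> \<in> cube_faces d \<and> \<gamma> \<psi> \<notin> D. cube_chain_sum y (free_dim d \<psi>)) =
      chain_functional y ([:0, 1:] ^ free_dim d \<phi> * [:1, 1:] ^ (d - free_dim d \<phi>))"
    unfolding set by (rule sum_cube_chain_sum)
  moreover have "{} \<in> D"
    using empty_in_open_domain[OF F False] unfolding D empty_in_union_face_lattices .
  ultimately show ?thesis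
    using stable_values_stable_value'[of "free_dim d \<phi>" d y] free_dim_le[of d \<phi>]
    by (simp add: stable_value'_def)
qed

end

text \<open>The isomorphism carries the parametrisation of \<open>C\<close> over to the polytope
  witnessing stability, which therefore has the face lattice of a \<open>d\<close>-cube; the sum
  depends only on the parameters.\<close>

lemma stable_cube_sum:
  assumes \<beta>: "cube_param d C \<beta>" and stable: "stable C D" and "D \<subseteq> C"
  shows "\<exists>j<2 * d + 2.
    (\<Sum>\<psi> | \<psi> \<in> cube_faces d \<and> \<beta> \<psi> \<notin> D. cube_chain_sum y (free_dim d \<psi>)) +
      (if {} \<in> D then 0 else 1) = stable_values y d j"
proof -
  obtain P F D' where P: "polytope P" and F: "F \<in> face_lattice P"
    and iso: "relative_isomorphic C D (face_lattice P) D'"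
    and D': "D' = (\<Union>G \<in> coatoms_above P F. face_lattice G) \<or>
      D' = (\<Union>G \<in> coatoms_above P {} - coatoms_above P F. face_lattice G)"
    using stable unfolding stable_def by metis
  obtain f where f: "order_isomorphism f C (face_lattice P)" "f ` D = D'"
    using iso unfolding relative_isomorphic_def by metis
  have empty: "{} \<in> face_lattice P" "{} \<in> C"
    using \<beta> by (simp_all add: face_lattice_def cube_param_def)
  have \<gamma>: "cube_param d (face_lattice P) (f \<circ> \<beta>)"
    by (rule cube_param_transfer[OF \<beta> f(1) empty(1)])
  have "inj_on f C"
    using f(1) by (simp add: order_isomorphism_def bij_betw_def)
  then have mem: "f X \<in> D' \<longleftrightarrow> X \<in> D" if "X \<in> C" for X
    using inj_on_image_mem_iff[of f C X D] that f(2) \<open>D \<subseteq> C\<close> by simp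
  have "{\<psi> \<in> cube_faces d. (f \<circ> \<beta>) \<psi> \<notin> D'} = {\<psi> \<in> cube_faces d. \<beta> \<psi> \<notin> D}"
    using mem cube_param_face_nonempty(1)[OF \<beta>] by (intro Collect_cong conj_cong refl) simp
  moreover have "{} \<in> D' \<longleftrightarrow> {} \<in> D"
    using mem[OF empty(2)] order_isomorphism_empty[OF f(1) empty(2,1)] by simp
  moreover have "\<exists>j<2 * d + 2.
    (\<Sum>\<psi> | \<psi> \<in> cube_faces d \<and> (f \<circ> \<beta>) \<psi> \<notin> D'. cube_chain_sum y (free_dim d \<psi>)) +
      (if {} \<in> D' then 0 else 1) = stable_values y d j"
    using D' closed_domain_sum[OF \<gamma> polytope_imp_convex[OF P] F, of D' y]
      open_domain_sum[OF \<gamma> polytope_imp_convex[OF P] F, of D' y] by blast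
  ultimately show ?thesis
    by simp
qed

lemma sum_chains_relative_cube:
  assumes \<beta>: "cube_param d L \<beta>"
  shows "(\<Sum>G\<in>L - D - {{}}. \<Sum>\<sigma>\<in>top_chains L G. y ^ card \<sigma>) =
    (\<Sum>\<psi> | \<psi> \<in> cube_faces d \<and> \<beta> \<psi> \<notin> D. cube_chain_sum y (free_dim d \<psi>))"
proof -
  let ?A = "{\<psi> \<in> cube_faces d. \<beta> \<psi> \<notin> D}"
  have "L - {{}} = \<beta> ` cube_faces d"
    using \<beta> by (simp add: cube_param_def bij_betw_def)
  moreover have "L - D - {{}} = (L - {{}}) - D"
    by blast
  moreover have "\<beta> ` cube_faces d - D = \<beta> ` ?A"
    by auto
  ultimately have "L - D - {{}} = \<beta> ` ?A"
    by simp
  moreover have "inj_on \<beta> ?A"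
    using cube_param_inj[OF \<beta>] by (rule inj_on_subset) simp
  ultimately have "(\<Sum>G\<in>L - D - {{}}. \<Sum>\<sigma>\<in>top_chains L G. y ^ card \<sigma>) =
      (\<Sum>\<psi>\<in>?A. \<Sum>\<sigma>\<in>top_chains L (\<beta> \<psi>). y ^ card \<sigma>)"
    by (simp add: sum.reindex)
  also have "\<dots> = (\<Sum>\<psi>\<in>?A. cube_chain_sum y (free_dim d \<psi>))"
    by (intro sum.cong refl sum_top_chains_cube[OF \<beta>]) simp
  finally show ?thesis .
qed

section \<open>Complexes with a stable shelling\<close>

lemma face_below_facet:
  assumes "finite K" "G \<in> K"
  obtains F where "F \<in> facets K" "G \<subseteq> F"
proof -
  obtain F where "F \<in> K" "G \<subseteq> F" "\<forall>H\<in>K. F \<subseteq> H \<longrightarrow> F = H"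
    using finite_has_maximal2[OF assms] by metis
  then show ?thesis
    using that[of F] unfolding facets_def by simp metis
qed

lemma attaching_complex_diff:
  "faces_in K (Fs ! i) - attaching_complex K Fs i = disjointed (\<lambda>i. faces_in K (Fs ! i)) i"
  by (auto simp: attaching_complex_def disjointed_def)

text \<open>Every nonempty face is new in exactly one facet of the list, and the chains ending in it
  can be computed inside that facet. The empty chain is charged to the first facet.\<close>

lemma sum_chains_shelling:
  fixes y :: complex
  assumes K: "finite K" "{} \<in> K" and Fs: "set Fs = facets K"
  shows "(\<Sum>\<sigma>\<in>sd K. y ^ card \<sigma>) = (\<Sum>i<length Fs.
    (\<Sum>G\<in>faces_in K (Fs ! i) - attaching_complex K Fs i - {{}}.
      \<Sum>\<sigma>\<in>top_chains (faces_in K (Fs ! i)) G. y ^ card \<sigma>) +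
    (if {} \<in> attaching_complex K Fs i then 0 else 1))"
proof -
  define n where "n = length Fs"
  define B where "B i = faces_in K (Fs ! i)" for i
  have "n \<noteq> 0"
    using face_below_facet[OF K] Fs unfolding n_def by fastforce
  \<comment> \<open>At index \<open>0\<close> the attaching complex has no faces at all, not even
    the empty one.\<close>
  have "{} \<in> attaching_complex K Fs i \<longleftrightarrow> i \<noteq> 0" for i
    using K(2) by (auto simp: attaching_complex_def faces_in_def)
  then have "(\<Sum>i<n. if {} \<in> attaching_complex K Fs i then 0 else 1 :: complex) =
      (\<Sum>i<n. if i = 0 then 1 else 0)"
    by (intro sum.cong) simp_all
  then have "(\<Sum>i<n. if {} \<in> attaching_complex K Fs i then 0 else 1 :: complex) = 1"
    using \<open>n \<noteq> 0\<close> by (simp add: sum.delta)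
  moreover have "(\<Sum>G\<in>K - {{}}. \<Sum>\<sigma>\<in>top_chains K G. y ^ card \<sigma>) =
      (\<Sum>i<n. \<Sum>G\<in>disjointed B i - {{}}. \<Sum>\<sigma>\<in>top_chains (B i) G. y ^ card \<sigma>)"
  proof -
    have "K \<subseteq> (\<Union>i\<in>{0..<n}. B i)"
    proof
      fix G assume G: "G \<in> K"
      then obtain F where "F \<in> facets K" "G \<subseteq> F"
        using face_below_facet[OF K(1)] by metis
      then obtain i where "i < n" "Fs ! i = F"
        using Fs unfolding n_def by (metis in_set_conv_nth)
      then show "G \<in> (\<Union>i\<in>{0..<n}. B i)"
        using G \<open>G \<subseteq> F\<close> by (auto simp: B_def faces_in_def)
    qed
    then have "K = (\<Union>i\<in>{0..<n}. B i)"
      by (auto simp: B_def faces_in_def)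
    then have K_eq: "K - {{}} = (\<Union>i\<in>{..<n}. disjointed B i - {{}})"
      unfolding finite_UN_disjointed_eq[of B n, symmetric] by (auto simp: atLeast0LessThan)
    have "(disjointed B i - {{}}) \<inter> (disjointed B j - {{}}) = {}" if "i \<noteq> j" for i j
      using disjoint_family_disjointed[of B] that by (auto simp: disjoint_family_on_def)
    moreover have "finite (disjointed B i - {{}})" for i
      using K(1) disjointed_subset[of B i] finite_subset[of "disjointed B i" K]
      by (auto simp: B_def faces_in_def)
    ultimately have "(\<Sum>G\<in>K - {{}}. \<Sum>\<sigma>\<in>top_chains K G. y ^ card \<sigma>) =
        (\<Sum>i<n. \<Sum>G\<in>disjointed B i - {{}}. \<Sum>\<sigma>\<in>top_chains K G. y ^ card \<sigma>)"
      unfolding K_eq by (intro sum.UNION_disjoint) simp_all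
    also have "\<dots> = (\<Sum>i<n. \<Sum>G\<in>disjointed B i - {{}}. \<Sum>\<sigma>\<in>top_chains (B i) G. y ^ card \<sigma>)"
    proof (intro sum.cong refl)
      fix i G assume "G \<in> disjointed B i - {{}}"
      then have "G \<subseteq> Fs ! i"
        by (auto simp: disjointed_def B_def faces_in_def)
      then have "faces_in K G = faces_in (B i) G"
        by (auto simp: B_def faces_in_def)
      then show "top_chains K G = top_chains (B i) G"
        by (rule top_chains_cong)
    qed
    finally show ?thesis .
  qed
  ultimately show ?thesis
    unfolding sd_def sum_chains[OF K(1)] attaching_complex_diff sum.distrib n_def B_def
    by (simp add: add.commute)
qed

section \<open>The h-polynomial at complex points\<close>

lemma map_poly_of_real_mult:
  "map_poly of_real (p * q) = (map_poly of_real p * map_poly of_real q :: complex poly)"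
  by (rule poly_eqI) (simp add: coeff_map_poly coeff_mult)

lemma map_poly_of_real_power:
  "map_poly of_real (p ^ n) = (map_poly of_real p ^ n :: complex poly)"
  by (induction n) (simp_all add: map_poly_of_real_mult)

lemma map_poly_of_real_sum:
  "map_poly of_real (sum f A) = (\<Sum>x\<in>A. map_poly of_real (f x) :: complex poly)"
  by (rule poly_eqI) (simp add: coeff_map_poly coeff_sum)

lemma complex_poly_h_poly:
  fixes z :: complex
  assumes S: "finite S" and "z \<noteq> 1"
  shows "poly (map_poly of_real (h_poly S)) z =
    (1 - z) ^ top_card S * (\<Sum>\<sigma>\<in>S. (z / (1 - z)) ^ card \<sigma>)"
proof -
  let ?m = "top_card S"
  have le: "card ` S \<subseteq> {..?m}"
    using S by (auto simp: top_card_def)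
  have "poly (map_poly of_real (h_poly S)) z =
      (\<Sum>j\<le>?m. of_nat (f_count S j) * z ^ j * (1 - z) ^ (?m - j))"
    by (simp add: h_poly_def map_poly_of_real_sum map_poly_of_real_mult map_poly_of_real_power
        map_poly_monom map_poly_pCons poly_sum poly_monom)
  also have "\<dots> = (\<Sum>j\<le>?m. (1 - z) ^ ?m * (of_nat (f_count S j) * (z / (1 - z)) ^ j))"
    using assms(2) by (intro sum.cong) (auto simp: power_diff power_divide)
  also have "\<dots> = (1 - z) ^ ?m * (\<Sum>j\<le>?m. \<Sum>\<sigma> | \<sigma> \<in> S \<and> card \<sigma> = j. (z / (1 - z)) ^ card \<sigma>)"
    by (simp add: sum_distrib_left f_count_def)
  also have "(\<Sum>j\<le>?m. \<Sum>\<sigma> | \<sigma> \<in> S \<and> card \<sigma> = j. (z / (1 - z)) ^ card \<sigma>) =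
      (\<Sum>\<sigma>\<in>S. (z / (1 - z)) ^ card \<sigma>)"
    by (rule sum.group[OF S _ le]) simp
  finally show ?thesis .
qed

text \<open>Each facet is a cube of some dimension, which \<open>face_dim\<close> recovers; purity
  makes these dimensions agree.\<close>

lemma stable_shelling_cube_param:
  assumes cubical: "cubical_complex C" and shell: "shelling C Fs"
  obtains d where "\<And>i. i < length Fs \<Longrightarrow> \<exists>\<beta>. cube_param d (faces_in C (Fs ! i)) \<beta>"
proof -
  obtain d where pure: "pure_of_dim d C" and Fs: "set Fs = facets C"
    using shell by (cases rule: shelling.cases) blast
  have "\<exists>\<beta>. cube_param (nat d) (faces_in C (Fs ! i)) \<beta>" if "i < length Fs" for i
  proof -
    let ?F = "Fs ! i"
    have F: "?F \<in> facets C"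
      using Fs that nth_mem by metis
    then obtain e f where f: "order_isomorphism f (faces_in C ?F) (face_lattice (std_cube e))"
      using cubical unfolding cubical_complex_def order_isomorphic_def by metis
    have "{} \<in> faces_in C ?F"
      using cubical by (simp add: cubical_complex_def polytopal_complex_def faces_in_def)
    then have \<beta>: "cube_param e (faces_in C ?F) (inv_into (faces_in C ?F) f \<circ> std_face e)"
      by (rule cube_param_transfer[OF cube_param_std_cube order_isomorphism_inv[OF f]])
    have "face_dim C ?F = int e"
      using F by (intro face_dim_cube[OF \<beta>]) (simp add: facets_def)
    moreover have "face_dim C ?F = d"
      using pure F by (simp add: pure_of_dim_def)
    ultimately show ?thesis
      using \<beta> by auto
  qed
  then show ?thesis
    using that by blast
qed

theorem theorem4p7:
  fixes C :: "'a set set"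
  assumes "cubical_complex C"
    and "\<exists>Fs. stable_shelling C Fs"
  shows "real_rooted (h_poly (sd C))"
proof -
  obtain Fs where shell: "shelling C Fs"
    and stable: "\<And>i. i < length Fs \<Longrightarrow> stable (faces_in C (Fs ! i)) (attaching_complex C Fs i)"
    using assms(2) unfolding stable_shelling_def by metis
  have C: "finite C" "{} \<in> C"
    using assms(1) by (simp_all add: cubical_complex_def polytopal_complex_def)
  have Fs: "set Fs = facets C"
    using shell by (cases rule: shelling.cases) simp
  obtain d where d: "\<And>i. i < length Fs \<Longrightarrow> \<exists>\<beta>. cube_param d (faces_in C (Fs ! i)) \<beta>"
    using stable_shelling_cube_param[OF assms(1) shell] by metis
  have "Fs \<noteq> []"
    using face_below_facet[OF C] Fs by (metis empty_iff empty_set)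
  have upper: "poly (map_poly of_real (h_poly (sd C))) z \<noteq> 0" if z: "0 < Im z" for z :: complex
  proof -
    define y where "y = z / (1 - z)"
    have "\<exists>j<2 * d + 2. (\<Sum>G\<in>faces_in C (Fs ! i) - attaching_complex C Fs i - {{}}.
          \<Sum>\<sigma>\<in>top_chains (faces_in C (Fs ! i)) G. y ^ card \<sigma>) +
        (if {} \<in> attaching_complex C Fs i then 0 else 1) = stable_values y d j"
      if i: "i < length Fs" for i
    proof -
      obtain \<beta> where \<beta>: "cube_param d (faces_in C (Fs ! i)) \<beta>"
        using d[OF i] by metis
      have "attaching_complex C Fs i \<subseteq> faces_in C (Fs ! i)"
        by (simp add: attaching_complex_def)
      then show ?thesis
        unfolding sum_chains_relative_cube[OF \<beta>] by (rule stable_cube_sum[OF \<beta> stable[OF i]])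
    qed
    \<comment> \<open>The indices may depend on \<open>z\<close>, which is harmless because
      nonvanishing is shown point by point.\<close>
    then obtain k where k: "\<And>i. i < length Fs \<Longrightarrow> k i < 2 * d + 2"
      and sum_k: "\<And>i. i < length Fs \<Longrightarrow>
        (\<Sum>G\<in>faces_in C (Fs ! i) - attaching_complex C Fs i - {{}}.
          \<Sum>\<sigma>\<in>top_chains (faces_in C (Fs ! i)) G. y ^ card \<sigma>) +
        (if {} \<in> attaching_complex C Fs i then 0 else 1) = stable_values y d (k i)"
      by metis
    have "(\<Sum>\<sigma>\<in>sd C. y ^ card \<sigma>) = (\<Sum>i<length Fs. stable_values y d (k i))"
      unfolding sum_chains_shelling[OF C Fs] by (intro sum.cong refl sum_k) simp
    also have "\<dots> \<noteq> 0"
      using z interlacing_at_stable_values[OF z, of d] \<open>Fs \<noteq> []\<close> k unfolding y_def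
      by (intro interlacing_at_sum_nonzero) auto
    finally have "(\<Sum>\<sigma>\<in>sd C. y ^ card \<sigma>) \<noteq> 0" .
    moreover have "finite (sd C)"
      using C(1) by (simp add: sd_def finite_chains)
    moreover have "z \<noteq> 1"
      using z by auto
    ultimately show ?thesis
      by (simp add: complex_poly_h_poly y_def)
  qed
  have "z \<in> \<real>" if root: "poly (map_poly of_real (h_poly (sd C))) z = 0" for z :: complex
  proof -
    \<comment> \<open>The coefficients are real, so a zero in the lower half-plane would have its
      conjugate as a zero in the upper one.\<close>
    have "poly (map_poly of_real (h_poly (sd C))) (cnj z) = 0"
      using root by (subst real_poly_cnj_root_iff) (simp_all add: coeff_map_poly)
    then have "\<not> 0 < Im z" "\<not> 0 < Im (cnj z)"
      using root upper by blast+
    then show ?thesis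
      by (simp add: complex_is_Real_iff)
  qed
  then show ?thesis
    by (simp add: real_rooted_def)
qed

end
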